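(* Let $\mathcal{T}$ be a rooted tree on $n$ vertices with bottleneck matrix $M$, and suppose $d$ is the eccentricity of the root. Let $r=n-d$, and let $Q_1$ and $M_1$ be the neckbottle matrix and the bottleneck matrix of $B_1(d,r)$, respectively. Then $c_3(Q_1,\mathbf{1})<\rho(M)$ and $c_3(M_1,\mathbf{1})<\rho(M)$, where $c_3(Q_1,\mathbf{1})=\frac{U_1(d,r)}{U_2(d,r)}$ and $c_3(M_1,\mathbf{1})=\frac{V_1(d,r)}{V_2(d,r)}$ with $U_1(d,r)=4r^3+2(d^2+3d+4)r^2+\tfrac1{12}(13d^4+26d^3+41d^2+28d+48)r+\tfrac1{2520}d(d+1)(2d+1)(68d^4+136d^3+133d^2+65d+18)$, $U_2(d,r)=4r^2+2(d^2+d+2)r+\tfrac1{30}d(d+1)(2d+1)(2d^2+2d+1)$, $V_1(d,r)=r^4+(4d+3)r^3+\tfrac12(2d+3)(d+2)(d+1)r^2+\tfrac1{15}(d+1)(4d^4+16d^3+19d^2+21d+15)r+\tfrac1{2520}d(2d+1)(d+1)(68d^4+136d^3+133d^2+65d+18)$, $V_2(d,r)=r^3+(3d+2)r^2+\tfrac13(d+1)(2d^2+4d+3)r+\tfrac1{30}d(2d+1)(d+1)(2d^2+2d+1)$. Moreover, for each $d\ge3$, the function $r\mapsto \frac{V_1(d,r)}{V_2(d,r)}-\frac{U_1(d,r)}{U_2(d,r)}$ has a root $r_0$ in the open interval $(0.4d^2-1,\,0.42d^2+2)$; further, $c_3(M_1,\mathbf{1})<c_3(Q_1,\mathbf{1})$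 for $0<r<r_0$ and $c_3(M_1,\mathbf{1})>c_3(Q_1,\mathbf{1})$ for $r>r_0$.
   Context: For a rooted tree with root $x$, its bottleneck matrix has $(i,j)$ entry equal to the number of vertices lying simultaneously on the path from $i$ to $x$ and on the path from $j$ to $x$. The path matrix $N$ has $(i,j)$ entry $1$ if vertex $i$ lies on the path from $j$ to $x$ (endpoints included) and $0$ otherwise; the neckbottle matrix is $NN^T$. The eccentricity of the root is the maximum distance from the root to another vertex. The broom $B(d,r)$ is obtained from a path on $d$ vertices by adding $r$ pendent vertices adjacent to one end-vertex $w$ of the path; $B_1(d,r)$ is this tree rooted at $w$. $\rho$ is the spectral radius, $\mathbf{1}$ the all-ones vector, and $c_3(A,\mathbf{1})=\frac{\mathbf{1}^TA^3\mathbf{1}}{\mathbf{1}^TA^2\mathbf{1}}$. *)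

theory Defs
  imports
    "Graph_Theory.Digraph_Component"
    "Graph_Theory.Shortest_Path"
    "Jordan_Normal_Form.Spectral_Radius"
begin

section \<open>Rooted trees\<close>

text \<open>
  An undirected simple graph is a \<^locale>\<open>pair_graph\<close>: a finite, loop-free digraph whose arc
  relation is symmetric.  In such a digraph every edge \<open>u - v\<close> yields the directed cycle
  \<open>u, v, u\<close>, so the library's \<^const>\<open>tree\<close>, which excludes all directed cycles, does not describe
  undirected trees.  The cycles of the undirected graph are the directed cycles of length at
  least 3.
\<close>

definition undirected_tree :: "'a pair_pre_digraph \<Rightarrow> bool" where
  "undirected_tree G \<longleftrightarrow>
     pair_graph G \<and> connected (with_proj G) \<and>
     \<not> (\<exists>p. pre_digraph.cycle (with_proj G) p \<and> 3 \<le> length p)"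

text \<open>Trees on the vertex set \<open>{0..<n}\<close>, so that matrices can be indexed by vertices.\<close>

definition rooted_tree :: "nat \<Rightarrow> nat pair_pre_digraph \<Rightarrow> nat \<Rightarrow> bool" where
  "rooted_tree n G x \<longleftrightarrow> undirected_tree G \<and> pverts G = {0..<n} \<and> x \<in> pverts G"

text \<open>The vertices of the path from \<open>u\<close> to \<open>v\<close>, endpoints included; in a tree the path is unique.\<close>

definition path_verts :: "'a pair_pre_digraph \<Rightarrow> 'a \<Rightarrow> 'a \<Rightarrow> 'a set" where
  "path_verts G u v =
     set (pre_digraph.awalk_verts (with_proj G) u
            (THE p. pre_digraph.apath (with_proj G) u p v))"

definition distance :: "'a pair_pre_digraph \<Rightarrow> 'a \<Rightarrow> 'a \<Rightarrow> ereal" where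
  "distance G u v = wf_digraph.\<mu> (with_proj G) (\<lambda>_. 1) u v"

text \<open>Meaningful only if \<open>G\<close> has a vertex other than \<open>x\<close>.\<close>

definition eccentricity :: "'a pair_pre_digraph \<Rightarrow> 'a \<Rightarrow> ereal" where
  "eccentricity G x = Max (distance G x ` (pverts G - {x}))"


section \<open>Matrices of rooted trees\<close>

definition bottleneck_mat :: "nat \<Rightarrow> nat pair_pre_digraph \<Rightarrow> nat \<Rightarrow> real mat" where
  "bottleneck_mat n G x =
     mat n n (\<lambda>(i, j). real (card (path_verts G i x \<inter> path_verts G j x)))"

definition path_mat :: "nat \<Rightarrow> nat pair_pre_digraph \<Rightarrow> nat \<Rightarrow> real mat" where
  "path_mat n G x = mat n n (\<lambda>(i, j). if i \<in> path_verts G j x then 1 else 0)"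

definition neckbottle_mat :: "nat \<Rightarrow> nat pair_pre_digraph \<Rightarrow> nat \<Rightarrow> real mat" where
  "neckbottle_mat n G x = path_mat n G x * transpose_mat (path_mat n G x)"

definition rho :: "real mat \<Rightarrow> real" where
  "rho A = spectral_radius (map_mat complex_of_real A)"

definition ones :: "nat \<Rightarrow> real vec" where
  "ones n = vec n (\<lambda>_. 1)"

definition c3 :: "real mat \<Rightarrow> real vec \<Rightarrow> real" where
  "c3 A v = scalar_prod v ((A ^\<^sub>m 3) *\<^sub>v v) / scalar_prod v ((A ^\<^sub>m 2) *\<^sub>v v)"


section \<open>Brooms\<close>

text \<open>
  The path is \<open>0 - 1 - \<dots> - (d - 1)\<close>, the end-vertex \<open>w\<close> is \<open>0\<close>, and the pendent vertices adjacent
  to \<open>w\<close> are \<open>d, \<dots>, d + r - 1\<close>.  The path is nonempty only for \<open>d \<ge> 1\<close>.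
\<close>

definition broom :: "nat \<Rightarrow> nat \<Rightarrow> nat pair_pre_digraph" where
  "broom d r =
     \<lparr> pverts = {0..<d + r},
       parcs = {(i, j). i < d \<and> j < d \<and> (j = Suc i \<or> i = Suc j)}
             \<union> {(0, k) | k. d \<le> k \<and> k < d + r}
             \<union> {(k, 0) | k. d \<le> k \<and> k < d + r} \<rparr>"

text \<open>The matrices of \<open>B\<^sub>1(d, r)\<close>, which is the broom rooted at \<open>w\<close>.\<close>

definition M1 :: "nat \<Rightarrow> nat \<Rightarrow> real mat" where
  "M1 d r = bottleneck_mat (d + r) (broom d r) 0"

definition Q1 :: "nat \<Rightarrow> nat \<Rightarrow> real mat" where
  "Q1 d r = neckbottle_mat (d + r) (broom d r) 0"


section \<open>The polynomials\<close>

definition U1 :: "real \<Rightarrow> real \<Rightarrow> real" where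
  "U1 d r = 4 * r^3 + 2 * (d^2 + 3*d + 4) * r^2
     + 1/12 * (13*d^4 + 26*d^3 + 41*d^2 + 28*d + 48) * r
     + 1/2520 * d * (d + 1) * (2*d + 1) * (68*d^4 + 136*d^3 + 133*d^2 + 65*d + 18)"

definition U2 :: "real \<Rightarrow> real \<Rightarrow> real" where
  "U2 d r = 4 * r^2 + 2 * (d^2 + d + 2) * r
     + 1/30 * d * (d + 1) * (2*d + 1) * (2*d^2 + 2*d + 1)"

definition V1 :: "real \<Rightarrow> real \<Rightarrow> real" where
  "V1 d r = r^4 + (4*d + 3) * r^3 + 1/2 * (2*d + 3) * (d + 2) * (d + 1) * r^2
     + 1/15 * (d + 1) * (4*d^4 + 16*d^3 + 19*d^2 + 21*d + 15) * r
     + 1/2520 * d * (2*d + 1) * (d + 1) * (68*d^4 + 136*d^3 + 133*d^2 + 65*d + 18)"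

definition V2 :: "real \<Rightarrow> real \<Rightarrow> real" where
  "V2 d r = r^3 + (3*d + 2) * r^2 + 1/3 * (d + 1) * (2*d^2 + 4*d + 3) * r
     + 1/30 * d * (2*d + 1) * (d + 1) * (2*d^2 + 2*d + 1)"

end

(* Write M = N^T N and Q = N N^T for the bottleneck and neckbottle matrices of a rooted tree with path
   matrix N, and apply N and N^T alternately to the all-ones vector, starting with either of them.
   By Cauchy-Schwarz the squared norms a_k = 1^T A^k 1 (A = M or A = Q) of the vectors so obtained
   form a log-convex sequence, and c_3 = a_3/a_2 < a_4/a_3 because N is unitriangular, hence
   injective, and the row sums A 1 are not constant.  So a_k grows at least like (a_4/a_3)^k, which
   forces the spectral radius above c_3.  A longest path from the root embeds the broom into the tree
   in such a way that the bottleneck matrix of the tree dominates that of the broom entrywise, so the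
   growth transfers to the tree.  The closed forms are sums of powers, and the numerator of
   V1/V2 - U1/U2 is r times a cubic g in r for which g(r)/r^2 is strictly increasing. *)

theory Submission
  imports Defs
begin

section \<open>Paths in rooted trees\<close>

text \<open>Only bottleneck matrices are compared entrywise. The neckbottle moments reach rho(M)
  through the identity 1^T Q^(k+1) 1 = (N^T 1)^T M^k (N^T 1): they too measure the growth of powers
  of the broom's M, from another starting vector. Comparing growth rates yields only \<le> rho(M),
  so all strictness has to come from the strict step a_3/a_2 < a_4/a_3. In exchange no Perron vector
  is needed: nonnegative entries and a bound on the entries of matrix powers suffice. The broom fits
  because its path has d vertices while a path from the root to a vertex at distance d has at least
  d + 1. Of each of the other r = n - d vertices it is only used that its path to the root contains
  the root and itself, which is all that a pendent vertex has.\<close>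

text \<open>Loop erasure turns \<open>p\<close> into a path that still avoids \<open>u\<close>, and
  going from \<open>u\<close> along it and back closes a cycle. Since \<open>a \<noteq> b\<close>,
  the path has an arc, so the cycle is longer than the 2-cycles that every edge produces.\<close>

lemma (in pair_sym_digraph) ex_cycle_if_two_neighbours_joined:
  assumes "(u, a) \<in> parcs G" "(u, b) \<in> parcs G" "a \<noteq> b"
    and "awalk a p b" "u \<notin> set (pawalk_verts a p)"
  shows "\<exists>c. cycle c \<and> 3 \<le> length c"
proof -
  define q where "q = awalk_to_apath p"
  have q: "apath a q b" using assms(4) unfolding q_def by (rule apath_awalk_to_apath)
  then have wq: "awalk a q b" and dq: "distinct (pawalk_verts a q)" by (auto simp: apath_def)
  have sub: "set q \<subseteq> set p" using awalk_to_apath_subset[OF assms(4)] by (simp add: q_def)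
  have u: "u \<notin> set (pawalk_verts a q)"
    using assms(5) sub set_awalk_verts[OF assms(4)] set_awalk_verts[OF wq] by auto
  have ne: "q \<noteq> []" using q assms(3) by (auto simp: apath_Nil_iff)
  have bu: "(b, u) \<in> parcs G" using assms(2) arcs_symmetric by blast
  have "awalk b [(b, u)] u" using arc_implies_awalk[OF bu] by simp
  with wq have w: "awalk a (q @ [(b, u)]) u" by (rule awalk_appendI)
  then have walk: "awalk u ((u, a) # q @ [(b, u)]) u"
    using assms(1) by (simp only: awalk_Cons_iff fst_conv snd_conv simp_thms)
  from awalk_verts_append[OF w] have "pawalk_verts a (q @ [(b, u)]) = pawalk_verts a q @ [u]"
    using wq by simp
  then have "distinct (tl (pawalk_verts u ((u, a) # q @ [(b, u)])))" using u dq by simp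
  then have "cycle ((u, a) # q @ [(b, u)])" using walk unfolding cycle_def by blast
  moreover have "3 \<le> length ((u, a) # q @ [(b, u)])" using ne by (cases q) auto
  ultimately show ?thesis by blast
qed

text \<open>Where two paths to \<open>v\<close> first part, the rest of one followed by the reverse
  of the rest of the other joins two neighbours of the branching vertex without meeting it.\<close>

lemma (in pair_sym_digraph) apath_unique:
  assumes "\<not> (\<exists>c. cycle c \<and> 3 \<le> length c)" "apath u p v" "apath u q v"
  shows "p = q"
  using assms(2,3)
proof (induction p arbitrary: u q)
  case Nil
  then show ?case using apath_nonempty_ends by (metis apath_Nil_iff)
next
  case (Cons e p)
  obtain f q' where q: "q = f # q'"
    using Cons.prems apath_nonempty_ends by (metis apath_Nil_iff list.exhaust list.simps(3))
  have e: "e \<in> parcs G" "fst e = u" "apath (snd e) p v" "u \<notin> set (pawalk_verts (snd e) p)"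
    using Cons.prems(1) by (auto simp: apath_Cons_iff)
  have f: "f \<in> parcs G" "fst f = u" "apath (snd f) q' v" "u \<notin> set (pawalk_verts (snd f) q')"
    using Cons.prems(2) by (auto simp: q apath_Cons_iff)
  show ?case
  proof (cases "snd e = snd f")
    case True
    then show ?thesis using Cons.IH[of "snd e" q'] e f by (simp add: q prod_eq_iff)
  next
    case False
    have wp: "awalk (snd e) p v" and wq: "awalk v (rev_path q') (snd f)"
      using e f by (auto simp: apath_def)
    have w: "awalk (snd e) (p @ rev_path q') (snd f)" using wp wq by auto
    have "set (pawalk_verts v (rev_path q')) = set (pawalk_verts (snd f) q')"
      using awalk_verts_rev_path[of "snd f" q' v] wq by simp
    then have "u \<notin> set (pawalk_verts (snd e) (p @ rev_path q'))"
      using set_awalk_verts_append[OF wp wq] e f by simp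
    then show ?thesis
      using ex_cycle_if_two_neighbours_joined[of u "snd e" "snd f"] e(1,2) f(1,2) False w assms(1)
      by (metis prod.collapse)
  qed
qed

lemma rooted_treeD:
  assumes "rooted_tree n G x"
  shows "pair_graph G" "pverts G = {0..<n}" "x < n" "connected (with_proj G)"
    "\<not> (\<exists>c. pre_digraph.cycle (with_proj G) c \<and> 3 \<le> length c)"
  using assms by (auto simp: rooted_tree_def undirected_tree_def)

text \<open>Uniqueness is a hypothesis on the single pair of ends, so the lemma serves trees and
  also brooms, whose paths to the root are determined directly.\<close>

lemma path_verts_eq:
  assumes "pre_digraph.apath (with_proj G) u p v"
    and "\<And>q. pre_digraph.apath (with_proj G) u q v \<Longrightarrow> q = p"
  shows "path_verts G u v = set (pawalk_verts u p)"
proof -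
  have "(THE p. pre_digraph.apath (with_proj G) u p v) = p" using assms by (rule the_equality)
  then show ?thesis by (simp add: path_verts_def awalk_verts_with_proj_eq)
qed

lemma rooted_tree_path_verts:
  assumes "rooted_tree n G x" "pre_digraph.apath (with_proj G) u p v"
  shows "path_verts G u v = set (pawalk_verts u p)"
proof -
  interpret pair_graph G using assms(1) by (rule rooted_treeD)
  show ?thesis
    using path_verts_eq[OF assms(2)] apath_unique[OF rooted_treeD(5)[OF assms(1)] _ assms(2)] by blast
qed

lemma rooted_tree_ex_apath:
  assumes "rooted_tree n G x" "u < n" "v < n"
  shows "\<exists>p. pre_digraph.apath (with_proj G) u p v"
proof -
  interpret pair_graph G using assms(1) by (rule rooted_treeD)
  have "u \<rightarrow>\<^sup>*\<^bsub>with_proj G\<^esub> v"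
    using rooted_treeD(2,4)[OF assms(1)] assms(2,3) reachable_mk_symmetric_eq[OF pair_sym_arcs]
    by (auto simp: connected_def strongly_connected_def)
  then show ?thesis by (simp add: reachable_apath)
qed

lemma rooted_tree_ends_in_path_verts:
  assumes "rooted_tree n G x" "u < n"
  shows "u \<in> path_verts G u x" "x \<in> path_verts G u x" "path_verts G u x \<subseteq> {0..<n}"
proof -
  interpret pair_graph G using assms(1) by (rule rooted_treeD)
  obtain p where p: "apath u p x"
    using rooted_tree_ex_apath[OF assms] rooted_treeD(3)[OF assms(1)] by blast
  then have w: "awalk u p x" by (simp add: apath_def)
  note eq = rooted_tree_path_verts[OF assms(1) p]
  show "u \<in> path_verts G u x" using eq hd_in_awalk_verts(1)[OF w] by simp
  have "last (pawalk_verts u p) = x" using w by simp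
  then show "x \<in> path_verts G u x"
    using eq w last_in_set awalk_verts_non_Nil by metis
  show "path_verts G u x \<subseteq> {0..<n}"
    using eq awalkE[OF w] rooted_treeD(2)[OF assms(1)] by auto
qed

lemma rooted_tree_path_verts_suffix:
  assumes "rooted_tree n G x" "pre_digraph.apath (with_proj G) u p x" "k \<le> length p"
  shows "path_verts G (pawalk_verts u p ! k) x = set (drop k (pawalk_verts u p))"
proof -
  interpret pair_graph G using assms(1) by (rule rooted_treeD)
  have w: "awalk u p x" and d: "distinct (pawalk_verts u p)" using assms(2) by (auto simp: apath_def)
  have dr: "pawalk_verts (pawalk_verts u p ! k) (drop k p) = drop k (pawalk_verts u p)"
    if "awalk u p x" "k \<le> length p" for u p k
    using that
  proof (induction p arbitrary: u k)
    case Nil then show ?case by simp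
  next
    case (Cons e p) then show ?case by (cases k) (auto simp: awalk_Cons_iff)
  qed
  have "awalk (pawalk_verts u p ! k) (drop k p) x"
    if "awalk u p x" "k \<le> length p" for u p k
    using that
  proof (induction p arbitrary: u k)
    case Nil then show ?case by simp
  next
    case (Cons e p) then show ?case by (cases k) (auto simp: awalk_Cons_iff)
  qed
  then have "awalk (pawalk_verts u p ! k) (drop k p) x" using w assms(3) by blast
  then have "apath (pawalk_verts u p ! k) (drop k p) x"
    using dr[OF w assms(3)] d by (simp add: apath_def)
  then show ?thesis using rooted_tree_path_verts[OF assms(1)] dr[OF w assms(3)] by metis
qed

lemma (in wf_digraph) awalk_cost_one: "awalk_cost (\<lambda>_. 1) p = real (length p)"
  by (simp add: awalk_cost_def sum_list_triv)

lemma rooted_tree_eccentricity: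
  assumes "rooted_tree n G x" "2 \<le> n" "eccentricity G x = ereal (real d)"
  shows "\<exists>u p. pre_digraph.apath (with_proj G) u p x \<and> d \<le> length p" "1 \<le> d"
proof -
  interpret pair_graph G using assms(1) by (rule rooted_treeD)
  note V = rooted_treeD(2,3)[OF assms(1)]
  have ne: "pverts G - {x} \<noteq> {}"
  proof
    assume "pverts G - {x} = {}"
    then have "{0..<n} \<subseteq> {x}" using V by auto
    then have "card {0..<n} \<le> card {x}" by (intro card_mono) auto
    then show False using assms(2) by simp
  qed
  have "eccentricity G x \<in> distance G x ` (pverts G - {x})"
    unfolding eccentricity_def using ne by (intro Max_in) auto
  then obtain u where u: "u \<in> pverts G" "u \<noteq> x" "ereal (real d) = distance G x u"
    using assms(3) by auto
  \<comment> \<open>The distance is an infimum of walk costs, and every walk between distinct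
    vertices has an arc. The resulting \<open>1 \<le> d\<close> makes the path of the broom
    nonempty.\<close>
  have "1 \<le> distance G x u"
    unfolding distance_def \<mu>_def
  proof (rule INF_greatest)
    fix p assume "p \<in> {p. awalk x p u}"
    then have "p \<noteq> []" using u(2) by (auto simp: awalk_Nil_iff)
    then show "1 \<le> ereal (awalk_cost (\<lambda>_. 1) p)"
      by (cases p) (auto simp: awalk_cost_one)
  qed
  then show "1 \<le> d" unfolding u(3)[symmetric] by simp
  obtain p where p: "apath u p x" using rooted_tree_ex_apath[OF assms(1)] V u(1) by fastforce
  \<comment> \<open>Distances are measured from the root, \<open>path_verts\<close> towards it, so
    the path is reversed.\<close>
  then have "awalk x (rev_path p) u" by (simp add: apath_def)
  from min_cost_le_walk_cost[OF this, of "\<lambda>_. 1"]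
  have "distance G x u \<le> real (length (rev_path p))" by (simp add: distance_def awalk_cost_one)
  moreover have "length (rev_path p) = length p" by (induction p) auto
  ultimately have "d \<le> length p" unfolding u(3)[symmetric] by simp
  then show "\<exists>u p. apath u p x \<and> d \<le> length p" using p by blast
qed

section \<open>Growth of matrix powers and the spectral radius\<close>

text \<open>Vectors and matrices are total functions of which only indices below \<open>n\<close>
  are read. This avoids dimension side conditions; \<open>mat_pow_mult_vec\<close> translates
  back.\<close>

definition dot :: "nat \<Rightarrow> (nat \<Rightarrow> real) \<Rightarrow> (nat \<Rightarrow> real) \<Rightarrow> real" where
  "dot n f g = (\<Sum>i<n. f i * g i)"

definition mv :: "nat \<Rightarrow> (nat \<Rightarrow> nat \<Rightarrow> real) \<Rightarrow> (nat \<Rightarrow> real) \<Rightarrow> nat \<Rightarrow> real" where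
  "mv n A f = (\<lambda>i. \<Sum>j<n. A i j * f j)"

abbreviation (input) tr :: "(nat \<Rightarrow> nat \<Rightarrow> real) \<Rightarrow> nat \<Rightarrow> nat \<Rightarrow> real" where
  "tr A \<equiv> \<lambda>i j. A j i"

text \<open>This is A^T A: the path matrix gives the bottleneck matrix, its transpose the neckbottle
  matrix.\<close>

definition gram :: "nat \<Rightarrow> (nat \<Rightarrow> nat \<Rightarrow> real) \<Rightarrow> nat \<Rightarrow> nat \<Rightarrow> real" where
  "gram n A = (\<lambda>i j. \<Sum>k<n. A k i * A k j)"

lemma mv_apply: "mv n A f i = (\<Sum>j<n. A i j * f j)"
  by (simp add: mv_def)

lemma mv_diff_scale: "mv n A (\<lambda>i. f i - c * g i) i = mv n A f i - c * mv n A g i"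
  by (simp add: mv_apply algebra_simps sum_subtractf sum_distrib_left)

lemma dot_mv: "dot n (mv n A f) g = dot n f (mv n (tr A) g)"
proof -
  have "dot n (mv n A f) g = (\<Sum>i<n. \<Sum>j<n. A i j * f j * g i)"
    unfolding dot_def mv_def sum_distrib_right ..
  also have "\<dots> = (\<Sum>j<n. \<Sum>i<n. A i j * f j * g i)" by (rule sum.swap)
  also have "\<dots> = (\<Sum>j<n. \<Sum>i<n. f j * (A i j * g i))"
    by (intro sum.cong refl) (simp only: mult_ac)
  also have "\<dots> = dot n f (mv n (tr A) g)"
    unfolding dot_def mv_def sum_distrib_left ..
  finally show ?thesis .
qed

lemma mv_gram: "mv n (gram n A) f = mv n (tr A) (mv n A f)"
proof
  fix i
  have "mv n (gram n A) f i = (\<Sum>j<n. \<Sum>k<n. A k i * A k j * f j)"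
    unfolding mv_def gram_def sum_distrib_right ..
  also have "\<dots> = (\<Sum>k<n. \<Sum>j<n. A k i * A k j * f j)" by (rule sum.swap)
  also have "\<dots> = (\<Sum>k<n. \<Sum>j<n. A k i * (A k j * f j))" by (simp only: mult.assoc)
  also have "\<dots> = mv n (tr A) (mv n A f) i"
    unfolding mv_def sum_distrib_left ..
  finally show "mv n (gram n A) f i = mv n (tr A) (mv n A f) i" .
qed

lemma tr_gram: "tr (gram n A) = gram n A"
  by (intro ext) (simp add: gram_def mult.commute)

section \<open>Growth of matrix powers against the spectral radius\<close>

lemma mat_pow_mult_vec:
  "(mat n n (\<lambda>(i, j). A i j)) ^\<^sub>m k *\<^sub>v vec n f = vec n ((mv n A ^^ k) f)"
proof (induction k arbitrary: f)
  case 0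
  have "1\<^sub>m n *\<^sub>v vec n f = vec n f" by (rule one_mult_mat_vec) auto
  then show ?case by simp
next
  case (Suc k)
  let ?A = "mat n n (\<lambda>(i, j). A i j)"
  have c: "?A \<in> carrier_mat n n" by simp
  have "?A ^\<^sub>m Suc k *\<^sub>v vec n f = ?A ^\<^sub>m k *\<^sub>v (?A *\<^sub>v vec n f)"
    using assoc_mult_mat_vec[OF pow_carrier_mat[OF c] c, of "vec n f" k] by simp
  also have "?A *\<^sub>v vec n f = vec n (mv n A f)"
    by (intro eq_vecI) (auto simp: mv_apply scalar_prod_def lessThan_atLeast0 intro!: sum.cong)
  finally show ?case using Suc by (simp add: funpow_swap1)
qed

lemma c3_eq_dot:
  "c3 (mat n n (\<lambda>(i, j). A i j)) (ones n) =
     dot n (\<lambda>_. 1) ((mv n A ^^ 3) (\<lambda>_. 1)) / dot n (\<lambda>_. 1) ((mv n A ^^ 2) (\<lambda>_. 1))"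
  by (simp add: c3_def ones_def mat_pow_mult_vec dot_def scalar_prod_def lessThan_atLeast0)

text \<open>The matrix B/c has spectral radius below 1, so its powers are bounded by its Jordan
  normal form. The strict inequality \<open>rho B < c\<close> absorbs the polynomial factors that
  Jordan blocks contribute.\<close>

lemma rho_less_imp_pow_bounded:
  assumes B: "B \<in> carrier_mat n n" and "rho B < c" "0 < c"
  shows "\<exists>K. \<forall>k. \<forall>i<n. \<forall>j<n. \<bar>(B ^\<^sub>m k) $$ (i, j)\<bar> \<le> K * c ^ k"
proof (cases "n = 0")
  case False
  let ?C = "map_mat complex_of_real B" and ?z = "complex_of_real (1 / c)"
  let ?D = "?z \<cdot>\<^sub>m ?C"
  have C: "?C \<in> carrier_mat n n" and D: "?D \<in> carrier_mat n n" using B by auto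
  have "spectral_radius ?D < 1"
  proof -
    obtain e where e: "e \<in> spectrum ?D" "spectral_radius ?D = norm e"
      using spectral_radius_mem_max(1)[OF D] False by blast
    then obtain v where v: "v \<in> carrier_vec n" "v \<noteq> 0\<^sub>v n" "?D *\<^sub>v v = e \<cdot>\<^sub>v v"
      using D by (auto simp: spectrum_def eigenvalue_def eigenvector_def)
    have "?D *\<^sub>v v = ?z \<cdot>\<^sub>v (?C *\<^sub>v v)"
      using C v(1) by (intro eq_vecI) (auto simp: row_smult smult_scalar_prod_distrib[of _ n])
    \<comment> \<open>Multiplying by \<open>c\<close> turns an eigenvalue \<open>e\<close> of B/c
      into the eigenvalue \<open>c * e\<close> of B.\<close>
    then have "complex_of_real c \<cdot>\<^sub>v (?z \<cdot>\<^sub>v (?C *\<^sub>v v)) = complex_of_real c \<cdot>\<^sub>v (e \<cdot>\<^sub>v v)"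
      using v(3) by simp
    then have "?C *\<^sub>v v = (complex_of_real c * e) \<cdot>\<^sub>v v"
      using assms(3) C v(1) by (simp add: smult_smult_assoc)
    then have "complex_of_real c * e \<in> spectrum ?C"
      using v C by (auto simp: spectrum_def eigenvalue_def eigenvector_def)
    then have "norm (complex_of_real c * e) \<le> rho B"
      using spectral_radius_mem_max(2)[OF C] False by (simp add: rho_def)
    then have "c * norm e \<le> rho B" using assms(3) by (simp add: norm_mult)
    then have "c * norm e < c * 1" using assms(2) by linarith
    then show ?thesis using e(2) assms(3) by (simp only: mult_less_cancel_left_pos)
  qed
  then obtain K where K: "\<And>k. norm_bound (?D ^\<^sub>m k) K"
    using spectral_radius_jnf_norm_bound_less_1_upper_triangular[OF D] by blast
  have Dk: "(?D ^\<^sub>m k) $$ (i, j) = complex_of_real ((1 / c) ^ k * (B ^\<^sub>m k) $$ (i, j))"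
    if "i < n" "j < n" for i j k
  proof -
    have "?D ^\<^sub>m k = (?z ^ k) \<cdot>\<^sub>m (?C ^\<^sub>m k)"
    proof (induction k)
      case (Suc k)
      have "?D ^\<^sub>m Suc k = (?z ^ k \<cdot>\<^sub>m ?C ^\<^sub>m k) * (?z \<cdot>\<^sub>m ?C)" by (simp only: pow_mat.simps Suc)
      also have "\<dots> = ?z \<cdot>\<^sub>m (?z ^ k \<cdot>\<^sub>m (?C ^\<^sub>m k * ?C))"
        using mult_smult_distrib[of "?z ^ k \<cdot>\<^sub>m ?C ^\<^sub>m k" n n ?C n ?z]
          mult_smult_assoc_mat[of "?C ^\<^sub>m k" n n ?C n "?z ^ k"] C by (simp add: pow_carrier_mat)
      finally show ?case by (intro eq_matI) auto
    qed (use C in \<open>intro eq_matI; auto\<close>)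
    moreover have "?C ^\<^sub>m k = map_mat complex_of_real (B ^\<^sub>m k)"
      using of_real_hom.mat_hom_pow[OF B] by metis
    ultimately show ?thesis
      using that carrier_matD[OF pow_carrier_mat[OF B, of k]] by (simp add: power_divide)
  qed
  show ?thesis
  proof (intro exI[of _ K] allI impI)
    fix k i j assume ij: "i < n" "j < n"
    have "norm ((?D ^\<^sub>m k) $$ (i, j)) \<le> K"
      using K[of k] ij carrier_matD[OF pow_carrier_mat[OF D, of k]] unfolding norm_bound_def by metis
    then have "\<bar>(1 / c) ^ k * (B ^\<^sub>m k) $$ (i, j)\<bar> \<le> K" using Dk[OF ij] by (metis norm_of_real real_norm_def)
    then show "\<bar>(B ^\<^sub>m k) $$ (i, j)\<bar> \<le> K * c ^ k"
      using assms(3) by (simp add: abs_mult power_divide field_simps)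
  qed
qed auto

lemma funpow_mv_Suc: "(mv n A ^^ Suc k) f i = (\<Sum>j<n. A i j * (mv n A ^^ k) f j)"
  unfolding funpow.simps o_apply by (rule mv_apply)

lemma funpow_mv_mono:
  assumes "bij_betw s {..<n} {..<n}"
    and A: "\<And>i j. i < n \<Longrightarrow> j < n \<Longrightarrow> 0 \<le> A i j \<and> A i j \<le> B (s i) (s j)"
    and f: "\<And>i. i < n \<Longrightarrow> 0 \<le> f i \<and> f i \<le> g (s i)" and "i < n"
  shows "0 \<le> (mv n A ^^ k) f i \<and> (mv n A ^^ k) f i \<le> (mv n B ^^ k) g (s i)"
  using \<open>i < n\<close>
proof (induction k arbitrary: i)
  case (Suc k)
  have "(\<Sum>j<n. A i j * (mv n A ^^ k) f j) \<le> (\<Sum>j<n. B (s i) (s j) * (mv n B ^^ k) g (s j))"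
    using Suc A by (intro sum_mono mult_mono) (auto intro: order_trans)
  also have "\<dots> = (\<Sum>j<n. B (s i) j * (mv n B ^^ k) g j)"
    by (rule sum.reindex_bij_betw[OF assms(1)])
  finally show ?case using Suc A by (auto simp only: funpow_mv_Suc intro!: sum_nonneg mult_nonneg_nonneg)
qed (use f in auto)

text \<open>If \<open>rho\<close> were below \<open>c\<close>, the powers of \<open>B\<close> would
  be O(c'^k) for some c' < c, and by domination so would the quadratic forms of \<open>A\<close>,
  against the growth hypothesis. The shift \<open>m\<close> lets the geometric growth start at a
  later power.\<close>

lemma rho_ge_growth_rate:
  assumes "bij_betw s {..<n} {..<n}"
    and A: "\<And>i j. i < n \<Longrightarrow> j < n \<Longrightarrow> 0 \<le> A i j \<and> A i j \<le> B (s i) (s j)"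
    and f: "\<And>i. i < n \<Longrightarrow> 0 \<le> f i \<and> f i \<le> b"
    and growth: "\<And>k. a * c ^ k \<le> dot n f ((mv n A ^^ (k + m)) f)" and "0 < a" "0 < c"
  shows "c \<le> rho (mat n n (\<lambda>(i, j). B i j))" (is "_ \<le> rho ?B")
proof (rule ccontr)
  assume "\<not> c \<le> rho ?B"
  then obtain c' where c': "rho ?B < c'" "0 < c'" "c' < c"
    \<comment> \<open>The maximum with 0 makes \<open>c'\<close> positive, as the power bound and
      the division by \<open>c'\<close> require.\<close>
    using \<open>0 < c\<close> dense[of "max 0 (rho ?B)" c] by auto
  have B: "?B \<in> carrier_mat n n" by simp
  obtain K where K: "\<And>k i j. i < n \<Longrightarrow> j < n \<Longrightarrow> \<bar>(?B ^\<^sub>m k) $$ (i, j)\<bar> \<le> K * c' ^ k"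
    using rho_less_imp_pow_bounded[OF B c'(1,2)] by blast
  have upper: "(mv n B ^^ k) (\<lambda>_. b) i \<le> real n * (K * c' ^ k * \<bar>b\<bar>)" if "i < n" for k i
  proof -
    have "(mv n B ^^ k) (\<lambda>_. b) i = (?B ^\<^sub>m k *\<^sub>v vec n (\<lambda>_. b)) $ i"
      unfolding mat_pow_mult_vec using that by simp
    also have "\<dots> = (\<Sum>j<n. (?B ^\<^sub>m k) $$ (i, j) * b)"
      using that pow_carrier_mat[OF B, of k] by (simp add: scalar_prod_def lessThan_atLeast0)
    also have "\<dots> \<le> (\<Sum>j<n. K * c' ^ k * \<bar>b\<bar>)"
    proof (rule sum_mono)
      fix j assume "j \<in> {..<n}"
      then have "\<bar>(?B ^\<^sub>m k) $$ (i, j)\<bar> * \<bar>b\<bar> \<le> K * c' ^ k * \<bar>b\<bar>"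
        using K that by (intro mult_right_mono) auto
      then show "(?B ^\<^sub>m k) $$ (i, j) * b \<le> K * c' ^ k * \<bar>b\<bar>"
        by (metis abs_ge_self abs_mult order_trans)
    qed
    finally show ?thesis by simp
  qed
  have "(c / c') ^ k \<le> real n * (b * (real n * (K * \<bar>b\<bar>))) * c' ^ m / a" for k
  proof -
    have "a * c ^ k \<le> (\<Sum>i<n. f i * (mv n A ^^ (k + m)) f i)" using growth by (simp add: dot_def)
    also have "\<dots> \<le> (\<Sum>i<n. b * (real n * (K * c' ^ (k + m) * \<bar>b\<bar>)))"
    proof (rule sum_mono)
      fix i assume "i \<in> {..<n}"
      then have i: "i < n" by simp
      then have si: "s i < n" using assms(1) by (auto simp: bij_betw_def)
      have "0 \<le> (mv n A ^^ (k + m)) f i \<and> (mv n A ^^ (k + m)) f i \<le> (mv n B ^^ (k + m)) (\<lambda>_. b) (s i)"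
        using funpow_mv_mono[of s n A B f "\<lambda>_. b" i "k + m"] assms(1) A f i by blast
      then show "f i * (mv n A ^^ (k + m)) f i \<le> b * (real n * (K * c' ^ (k + m) * \<bar>b\<bar>))"
        using f[OF i] upper[OF si, of "k + m"] by (intro mult_mono) auto
    qed
    finally show ?thesis using \<open>0 < a\<close> c'(2) by (simp add: power_divide power_add field_simps)
  qed
  moreover have "1 < c / c'" using c' by simp
  ultimately show False using real_arch_pow[of "c / c'"] by (metis not_less)
qed

section \<open>Log-convex sequences and the Cauchy-Schwarz inequality\<close>

lemma log_convex_growth:
  fixes a :: "nat \<Rightarrow> real"
  assumes "\<And>k. 0 < a k" "\<And>k. (a (Suc k))\<^sup>2 \<le> a k * a (Suc (Suc k))"
  shows "a m * (a (Suc m) / a m) ^ k \<le> a (m + k)"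
proof -
  have ratio: "a (Suc m) / a m \<le> a (Suc (m + k)) / a (m + k)" for k
  proof (induction k)
    case (Suc k)
    have "a (Suc (m + k)) / a (m + k) \<le> a (Suc (Suc (m + k))) / a (Suc (m + k))"
      using assms(1)[of "m + k"] assms(1)[of "Suc (m + k)"] assms(2)[of "m + k"]
      by (simp add: field_simps power2_eq_square)
    then show ?case using Suc by simp
  qed simp
  show ?thesis
  proof (induction k)
    case (Suc k)
    have "a m * (a (Suc m) / a m) ^ Suc k = (a m * (a (Suc m) / a m) ^ k) * (a (Suc m) / a m)" by simp
    also have "\<dots> \<le> a (m + k) * (a (Suc (m + k)) / a (m + k))"
      using Suc ratio assms(1) by (intro mult_mono) (auto intro: less_imp_le)
    also have "\<dots> = a (m + Suc k)" using assms(1)[of "m + k"] by simp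
    finally show ?case .
  qed simp
qed

text \<open>The residual of projecting \<open>g\<close> onto \<open>f\<close>, multiplied by
  \<open>dot n f f\<close> to avoid division. Its nonnegativity gives the Cauchy-Schwarz inequality,
  its vanishing the equality case.\<close>

lemma sum_projection_residual:
  "(\<Sum>i<n. (dot n f f * g i - dot n f g * f i)\<^sup>2) =
    dot n f f * (dot n f f * dot n g g - (dot n f g)\<^sup>2)"
proof -
  define p q where "p = dot n f f" and "q = dot n f g"
  have "(\<Sum>i<n. (p * g i - q * f i)\<^sup>2) = p\<^sup>2 * dot n g g - 2 * p * q * dot n f g + q\<^sup>2 * dot n f f"
    by (simp add: dot_def power2_eq_square algebra_simps sum.distrib sum_subtractf sum_distrib_left)
  also have "\<dots> = p * (dot n f f * dot n g g - (dot n f g)\<^sup>2)"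
    by (simp add: p_def q_def power2_eq_square algebra_simps)
  finally show ?thesis by (simp add: p_def q_def)
qed

lemma cauchy_schwarz_dot: "(dot n f g)\<^sup>2 \<le> dot n f f * dot n g g"
proof (cases "dot n f f = 0")
  case True
  then have "\<forall>i\<in>{..<n}. f i * f i = 0"
    unfolding dot_def by (subst (asm) sum_nonneg_eq_0_iff) auto
  then show ?thesis by (simp add: dot_def)
next
  case False
  then have "0 < dot n f f" using sum_nonneg[of "{..<n}" "\<lambda>i. f i * f i"] by (simp add: dot_def)
  moreover have "0 \<le> dot n f f * (dot n f f * dot n g g - (dot n f g)\<^sup>2)"
    unfolding sum_projection_residual[symmetric] by (simp add: sum_nonneg)
  ultimately show ?thesis by (simp add: zero_le_mult_iff)
qed

lemma cauchy_schwarz_dot_eqD: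
  assumes "(dot n f g)\<^sup>2 = dot n f f * dot n g g" "i < n"
  shows "dot n f f * g i = dot n f g * f i"
proof -
  have "(\<Sum>i<n. (dot n f f * g i - dot n f g * f i)\<^sup>2) = 0"
    unfolding sum_projection_residual using assms(1) by simp
  then have "\<forall>i\<in>{..<n}. (dot n f f * g i - dot n f g * f i)\<^sup>2 = 0"
    by (subst (asm) sum_nonneg_eq_0_iff) auto
  then show ?thesis using assms(2) by simp
qed

section \<open>Moments of a Gram matrix\<close>

context
  fixes n :: nat and A :: "nat \<Rightarrow> nat \<Rightarrow> real"
begin

definition mom :: "nat \<Rightarrow> real" where
  "mom k = dot n (\<lambda>_. 1) ((mv n (gram n A) ^^ k) (\<lambda>_. 1))"

private abbreviation "it k \<equiv> (mv n (gram n A) ^^ k) (\<lambda>_. 1)"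

lemma dot_it: "dot n (it i) (it j) = mom (i + j)"
proof (induction i arbitrary: j)
  case (Suc i)
  have "dot n (it (Suc i)) (it j) = dot n (it i) (it (Suc j))"
    by (simp add: dot_mv tr_gram)
  then show ?case using Suc[of "Suc j"] by simp
qed (simp add: mom_def)

lemma dot_mv_it: "dot n (mv n A (it i)) (mv n A (it j)) = mom (Suc (i + j))"
proof -
  have "dot n (mv n A (it i)) (mv n A (it j)) = dot n (it i) (it (Suc j))"
    by (simp add: dot_mv mv_gram)
  then show ?thesis using dot_it[of i "Suc j"] by simp
qed

lemma mom_log_convex: "(mom (Suc k))\<^sup>2 \<le> mom k * mom (Suc (Suc k))"
\<comment> \<open>For even \<open>k\<close> the inequality is Cauchy-Schwarz for consecutive
  iterates. For odd \<open>k\<close> one further application of \<open>A\<close> to both acts as the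
  half power of \<open>gram n A\<close>.\<close>
proof (cases "even k")
  case True
  then obtain m where k: "k = m + m" by (metis evenE mult_2)
  show ?thesis using cauchy_schwarz_dot[of n "it m" "it (Suc m)"] unfolding dot_it k by simp
next
  case False
  then obtain m where k: "k = Suc (m + m)" by (metis oddE mult_2 Suc_eq_plus1)
  show ?thesis using cauchy_schwarz_dot[of n "mv n A (it m)" "mv n A (it (Suc m))"]
    unfolding dot_mv_it k by simp
qed

context
  assumes nonneg: "\<And>i j. i < n \<Longrightarrow> j < n \<Longrightarrow> 0 \<le> A i j"
    and diag: "\<And>i. i < n \<Longrightarrow> A i i = 1"
    and n: "0 < n"
begin

lemma it_ge_1: "i < n \<Longrightarrow> 1 \<le> it k i"
proof (induction k arbitrary: i)
  case (Suc k)
  have g: "0 \<le> gram n A i j" if "j < n" for j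
    using Suc.prems that nonneg by (auto simp: gram_def intro!: sum_nonneg)
  have nn: "0 \<le> gram n A i j * it k j" if "j < n" for j
    using g[OF that] Suc.IH[OF that] by simp
  have "A i i * A i i \<le> gram n A i i"
    unfolding gram_def using Suc.prems nonneg by (intro member_le_sum[of i "{..<n}" "\<lambda>k. A k i * A k i"]) auto
  then have "1 * 1 \<le> gram n A i i * it k i"
    using Suc diag by (intro mult_mono) auto
  also have "\<dots> \<le> it (Suc k) i"
    unfolding funpow_mv_Suc using Suc.prems nn
    by (intro member_le_sum[of i "{..<n}" "\<lambda>j. gram n A i j * it k j"]) auto
  finally show ?case by (simp only: mult_1)
qed simp

lemma mom_pos: "0 < mom k"
proof -
  have "0 < it k i" if "i < n" for i using it_ge_1[OF that, of k] by linarith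
  then have "0 < (\<Sum>i<n. it k i)" using n by (intro sum_pos) auto
  then show ?thesis by (simp add: mom_def dot_def)
qed

text \<open>Equality would make the first two iterates proportional, so that the first iterate minus
  a multiple of the all-ones vector lies in the kernel of \<open>gram n A\<close>. Injectivity then
  makes the row sums constant.\<close>

lemma mom_strict:
  assumes inj: "\<And>f i. (\<And>i. i < n \<Longrightarrow> mv n A f i = 0) \<Longrightarrow> i < n \<Longrightarrow> f i = 0"
    and nonconst: "i < n" "j < n" "mv n (gram n A) (\<lambda>_. 1) i \<noteq> mv n (gram n A) (\<lambda>_. 1) j"
  shows "mom 3 / mom 2 < mom 4 / mom 3"
proof -
  have "(mom 3)\<^sup>2 \<noteq> mom 2 * mom 4"
  proof
    assume eq: "(mom 3)\<^sup>2 = mom 2 * mom 4"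
    let ?l = "mom 3 / mom 2"
    let ?g = "\<lambda>i. it 1 i - ?l * 1"
    have eig: "it 2 i = ?l * it 1 i" if "i < n" for i
      using cauchy_schwarz_dot_eqD[of n "it 1" "it 2", unfolded dot_it] eq that mom_pos[of 2]
      by (simp add: field_simps numeral_eq_Suc)
    have ker: "mv n (gram n A) ?g i = 0" if "i < n" for i
    proof -
      have "mv n (gram n A) ?g i = it 2 i - ?l * it 1 i"
        unfolding mv_diff_scale by (simp add: numeral_2_eq_2)
      then show ?thesis using eig that by simp
    qed
    \<comment> \<open>A^T A g = 0 forces |A g|^2 = 0, which reduces the claim to injectivity of
      \<open>A\<close> itself.\<close>
    have "dot n (mv n A ?g) (mv n A ?g) = dot n ?g (mv n (gram n A) ?g)"
      by (simp add: dot_mv mv_gram)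
    also have "\<dots> = 0" using ker by (simp add: dot_def)
    finally have "\<forall>i\<in>{..<n}. (mv n A ?g i)\<^sup>2 = 0"
      by (subst (asm) dot_def, subst (asm) sum_nonneg_eq_0_iff) (auto simp: power2_eq_square)
    then have "?g i = 0" if "i < n" for i using inj[of ?g i] that by simp
    then show False using nonconst by simp
  qed
  then have "(mom 3)\<^sup>2 < mom 2 * mom 4" using mom_log_convex[of 2] by (simp add: numeral_eq_Suc)
  then show ?thesis using mom_pos[of 2] mom_pos[of 3] by (simp add: field_simps power2_eq_square)
qed

end

end

text \<open>Regrouping the factors of (A A^T)^(k+1) leaves one A^T at each end, applied to the
  all-ones vector. Thus a bound on the growth of powers of A^T A also controls the moments of A
  A^T.\<close>

lemma mom_tr: "mom n (tr A) (Suc k) =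
  dot n (mv n (tr A) (\<lambda>_. 1)) ((mv n (gram n A) ^^ k) (mv n (tr A) (\<lambda>_. 1)))"
proof -
  have "(mv n (gram n (tr A)) ^^ Suc k) f = mv n A ((mv n (gram n A) ^^ k) (mv n (tr A) f))" for f
    by (induction k) (simp_all add: mv_gram)
  then have "mom n (tr A) (Suc k) =
      dot n (\<lambda>_. 1) (mv n A ((mv n (gram n A) ^^ k) (mv n (tr A) (\<lambda>_. 1))))"
    by (simp only: mom_def)
  also have "\<dots> = dot n (mv n (tr A) (\<lambda>_. 1)) ((mv n (gram n A) ^^ k) (mv n (tr A) (\<lambda>_. 1)))"
    by (simp only: dot_mv)
  finally show ?thesis .
qed

lemma c3_gram_less_rho:
  assumes entries: "\<And>i j. i < n \<Longrightarrow> j < n \<Longrightarrow> 0 \<le> A i j \<and> A i j \<le> 1" "\<And>i. i < n \<Longrightarrow> A i i = 1" "0 < n"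
    and s: "bij_betw s {..<n} {..<n}"
      "\<And>i j. i < n \<Longrightarrow> j < n \<Longrightarrow> gram n A i j \<le> B (s i) (s j)"
    and inj: "\<And>f i. (\<And>i. i < n \<Longrightarrow> mv n A f i = 0) \<Longrightarrow> i < n \<Longrightarrow> f i = 0"
      "\<And>f i. (\<And>i. i < n \<Longrightarrow> mv n (tr A) f i = 0) \<Longrightarrow> i < n \<Longrightarrow> f i = 0"
    and nonconst: "i < n" "j < n" "mv n (gram n A) (\<lambda>_. 1) i \<noteq> mv n (gram n A) (\<lambda>_. 1) j"
      "i' < n" "j' < n" "mv n (gram n (tr A)) (\<lambda>_. 1) i' \<noteq> mv n (gram n (tr A)) (\<lambda>_. 1) j'"
  shows "mom n A 3 / mom n A 2 < rho (mat n n (\<lambda>(i, j). B i j))"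
    "mom n (tr A) 3 / mom n (tr A) 2 < rho (mat n n (\<lambda>(i, j). B i j))"
proof -
  let ?B = "mat n n (\<lambda>(i, j). B i j)"
  have g: "0 \<le> gram n A i j \<and> gram n A i j \<le> B (s i) (s j)" if "i < n" "j < n" for i j
    using that entries(1) s(2) by (auto simp: gram_def intro!: sum_nonneg)
  have pos: "0 < mom n A k" "0 < mom n (tr A) k" for k
    using entries by (auto intro!: mom_pos)
  have nonneg: "0 \<le> A i j" if "i < n" "j < n" for i j using entries(1) that by blast
  have "mom n A 3 / mom n A 2 < mom n A 4 / mom n A 3"
  proof (rule mom_strict)
    show "f i = 0" if "\<And>i. i < n \<Longrightarrow> mv n A f i = 0" "i < n" for f i using inj(1) that by blast
  qed (fact nonneg entries(2,3) nonconst(1-3))+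
  also have "mom n A 4 / mom n A 3 \<le> rho ?B"
  proof (rule rho_ge_growth_rate[where A = "gram n A" and B = B, OF s(1) g])
    fix k
    have "mom n A 3 * (mom n A 4 / mom n A 3) ^ k \<le> mom n A (3 + k)"
      using log_convex_growth[of "mom n A" 3 k] pos mom_log_convex by (simp add: numeral_eq_Suc)
    then show "mom n A 3 * (mom n A 4 / mom n A 3) ^ k \<le> dot n (\<lambda>_. 1) ((mv n (gram n A) ^^ (k + 3)) (\<lambda>_. 1))"
      by (simp only: mom_def add.commute)
  next
    fix i show "0 \<le> (1::real) \<and> (1::real) \<le> 1" by simp
  qed (use pos in auto)
  finally show "mom n A 3 / mom n A 2 < rho ?B" .
  let ?f = "mv n (tr A) (\<lambda>_. 1)"
  have "mom n (tr A) 3 / mom n (tr A) 2 < mom n (tr A) 4 / mom n (tr A) 3"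
  proof (rule mom_strict)
    show "f i = 0" if "\<And>i. i < n \<Longrightarrow> mv n (tr A) f i = 0" "i < n" for f i using inj(2) that by blast
    show "0 \<le> A j i" if "i < n" "j < n" for i j using nonneg that by blast
  qed (fact entries(2,3) nonconst(4-6))+
  also have "mom n (tr A) 4 / mom n (tr A) 3 \<le> rho ?B"
  proof (rule rho_ge_growth_rate[where A = "gram n A" and B = B, OF s(1) g])
    fix k
    \<comment> \<open>The shift is 2 here and was 3 before: one power is spent on the starting
      vector.\<close>
    have "mom n (tr A) 3 * (mom n (tr A) 4 / mom n (tr A) 3) ^ k \<le> mom n (tr A) (3 + k)"
      using log_convex_growth[of "mom n (tr A)" 3 k] pos mom_log_convex by (simp add: numeral_eq_Suc)
    also have "\<dots> = mom n (tr A) (Suc (k + 2))" by (rule arg_cong[of _ _ "mom n (tr A)"]) simp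
    also have "\<dots> = dot n ?f ((mv n (gram n A) ^^ (k + 2)) ?f)" by (rule mom_tr)
    finally show "mom n (tr A) 3 * (mom n (tr A) 4 / mom n (tr A) 3) ^ k
      \<le> dot n ?f ((mv n (gram n A) ^^ (k + 2)) ?f)" .
  next
    fix i assume i: "i < n"
    have "(\<Sum>j<n. A j i) \<le> (\<Sum>j<n. 1)" using entries(1) i by (intro sum_mono) auto
    moreover have "0 \<le> (\<Sum>j<n. A j i)" using entries(1) i by (intro sum_nonneg) auto
    ultimately show "0 \<le> ?f i \<and> ?f i \<le> real n" by (simp add: mv_apply)
  qed (use pos in auto)
  finally show "mom n (tr A) 3 / mom n (tr A) 2 < rho ?B" .
qed

section \<open>The polynomial inequality\<close>

definition cross0 :: "real \<Rightarrow> real" where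
  "cross0 d = -16 * d^10 - 140 * d^9 - 750 * d^8 + 240 * d^7 + 8967 * d^6 + 6510 * d^5 - 13550 * d^4 - 22540 * d^3 - 13551 * d^2 - 2970 * d"

definition cross1 :: "real \<Rightarrow> real" where
  "cross1 d = -1080 * d^8 + 720 * d^7 + 11970 * d^6 - 16695 * d^5 - 5670 * d^4 + 24255 * d^3 - 5220 * d^2 - 8280 * d"

definition cross2 :: "real \<Rightarrow> real" where
  "cross2 d = -2040 * d^7 + 13020 * d^6 - 23100 * d^5 + 15225 * d^4 - 40110 * d^3 + 66255 * d^2 + 8550 * d"

definition cross3 :: "real \<Rightarrow> real" where
  "cross3 d = 5040 * d^5 - 28350 * d^4 + 56700 * d^3 - 47250 * d^2 + 13860 * d"

definition cross :: "real \<Rightarrow> real \<Rightarrow> real" where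
  "cross d r = cross3 d * r^3 + cross2 d * r^2 + cross1 d * r + cross0 d"

text \<open>37800 clears the denominators. The coefficients of r^6 and r^5 cancel, and so does the
  constant term, because \<open>V1\<close>, \<open>U1\<close> and likewise \<open>V2\<close>,
  \<open>U2\<close> agree at r = 0; what remains is \<open>r\<close> times a cubic.\<close>

lemma cross_eq: "37800 * (V1 d r * U2 d r - U1 d r * V2 d r) = r * cross d r"
  unfolding cross_def cross0_def cross1_def cross2_def cross3_def U1_def U2_def V1_def V2_def
  by (simp add: field_simps power2_eq_square power3_eq_cube eval_nat_numeral)

lemma cross_scaled:
  assumes "k \<noteq> 0"
  shows "k^3 * cross d (s / k) = cross3 d * s^3 + k * cross2 d * s^2 + k^2 * cross1 d * s + k^3 * cross0 d"
  using assms by (simp add: cross_def field_simps power2_eq_square power3_eq_cube)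

text \<open>In terms of \<open>e = d - 3\<close> all coefficients of the polynomials below have the same sign.\<close>

lemma cross_coefficient_signs:
  assumes "3 \<le> d"
  shows "cross0 d < 0" "cross1 d < 0" "0 < cross3 d"
proof -
  define e where "e = d - 3"
  then have e: "0 \<le> e" and d: "d = e + 3" using assms by auto
  have "- cross0 d = (((((((((16 * e + 620) * e + 11010) * e + 114960) * e + 764673) * e + 3329340) * e + 9467015) * e + 17054740) * e + 18126186) * e + 9759240) * e + 1814400"
    unfolding cross0_def d by (simp add: algebra_simps eval_nat_numeral)
  also have "\<dots> > 0" using e by (intro add_nonneg_pos mult_nonneg_nonneg add_nonneg_nonneg) auto
  finally show "cross0 d < 0" by simp
  have "- cross1 d = (((((((1080 * e + 25200) * e + 245070) * e + 1298115) * e + 4083345) * e + 7737975) * e + 8428005) * e + 4527810) * e + 718200"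
    unfolding cross1_def d by (simp add: algebra_simps eval_nat_numeral)
  also have "\<dots> > 0" using e by (intro add_nonneg_pos mult_nonneg_nonneg add_nonneg_nonneg) auto
  finally show "cross1 d < 0" by simp
  have "cross3 d = ((((5040 * e + 47250) * e + 170100) * e + 292950) * e + 240660) * e + 75600"
    unfolding cross3_def d by (simp add: algebra_simps eval_nat_numeral)
  also have "\<dots> > 0" using e by (intro add_nonneg_pos mult_nonneg_nonneg add_nonneg_nonneg) auto
  finally show "0 < cross3 d" .
qed

text \<open>The point is 0.4 d^2 - 1. At r = s d^2 the leading term of \<open>cross\<close> is (5040
  s^3 - 2040 s^2) d^11, which changes sign at s = 17/42 = 0.4047..., between 0.4 and 0.42.\<close>

lemma cross_lower:
  assumes "3 \<le> d"
  shows "cross d ((2 * d^2 - 5) / 5) < 0"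
proof -
  define e where "e = d - 3"
  then have e: "0 \<le> e" and d: "d = e + 3" using assms by auto
  have "- (5^3 * cross d ((2 * d^2 - 5) / 5)) = ((((((((((480 * e + 38240) * e + 997900) * e + 12629250) * e + 93026670) * e + 438297825) * e + 1385729145) * e + 2973559975) * e + 4201957325) * e + 3570213510) * e + 1467100080) * e + 134416800"
    unfolding cross_scaled[of 5, OF zero_neq_numeral[symmetric]] cross0_def cross1_def cross2_def cross3_def d
    by (simp add: algebra_simps eval_nat_numeral)
  also have "\<dots> > 0" using e by (intro add_nonneg_pos mult_nonneg_nonneg add_nonneg_nonneg) auto
  finally show ?thesis by simp
qed

lemma cross_upper:
  assumes "3 \<le> d"
  shows "cross d ((21 * d^2 + 100) / 50) > 0"
proof -
  define e where "e = d - 3"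
  then have e: "0 \<le> e" and d: "d = e + 3" using assms by auto
  have "(50^3 * cross d ((21 * d^2 + 100) / 50)) = ((((((((((1693440 * e + 21725170) * e + 87938000) * e + 266206350) * e + 6403994460) * e + 78286058550) * e + 484541672160) * e + 1790667179450) * e + 4154246215900) * e + 5972082608880) * e + 4938814590840) * e + 1868374166400"
    unfolding cross_scaled[of 50, OF zero_neq_numeral[symmetric]] cross0_def cross1_def cross2_def cross3_def d
    by (simp add: algebra_simps eval_nat_numeral)
  also have "\<dots> > 0" using e by (intro add_nonneg_pos mult_nonneg_nonneg add_nonneg_nonneg) auto
  finally show ?thesis by simp
qed

text \<open>This is the monotonicity of \<open>r \<mapsto> cross d r / r\<^sup>2\<close>, freed of denominators.\<close>

lemma cross_strict_mono:
  assumes "3 \<le> d" "0 < r" "r < s"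
  shows "cross d r * s^2 < cross d s * r^2"
proof -
  have "cross d s * r^2 - cross d r * s^2 =
      (s - r) * (cross3 d * (r^2 * s^2) + (- cross1 d) * (r * s) + (- cross0 d) * (s + r))"
    by (simp add: cross_def algebra_simps power2_eq_square power3_eq_cube)
  also have "\<dots> > 0"
    using cross_coefficient_signs[OF assms(1)] assms(2,3) by (intro mult_pos_pos add_pos_pos) auto
  finally show ?thesis by simp
qed

lemma cross_has_root:
  assumes "3 \<le> d"
  shows "\<exists>r0. 0.4 * d^2 - 1 < r0 \<and> r0 < 0.42 * d^2 + 2 \<and> 0 < r0 \<and> cross d r0 = 0 \<and>
    (\<forall>r. 0 < r \<and> r < r0 \<longrightarrow> cross d r < 0) \<and> (\<forall>r. r0 < r \<longrightarrow> 0 < cross d r)"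
proof -
  let ?a = "(2 * d^2 - 5) / 5" and ?b = "(21 * d^2 + 100) / 50"
  have ab: "?a < ?b" by (simp add: field_simps add_nonneg_pos)
  have cont: "continuous_on {?a..?b} (cross d)"
    unfolding cross_def by (intro continuous_intros)
  obtain r0 where r0: "?a \<le> r0" "r0 \<le> ?b" "cross d r0 = 0"
    using IVT'[of "cross d" ?a 0 ?b] cross_lower[OF assms] cross_upper[OF assms] ab cont by auto
  have "r0 \<noteq> ?a" using r0(3) cross_lower[OF assms] by (metis less_irrefl)
  moreover have "r0 \<noteq> ?b" using r0(3) cross_upper[OF assms] by (metis less_irrefl)
  ultimately have strict: "?a < r0" "r0 < ?b" using r0(1,2) by linarith+
  \<comment> \<open>For d \<ge> 3 the lower end 0.4 d^2 - 1 is at least 2.6, so the root is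
    positive.\<close>
  have "3 * 3 \<le> d * d" using assms by (intro mult_mono) auto
  then have pos: "0 < r0" using strict(1) by (simp add: power2_eq_square)
  \<comment> \<open>Since \<open>cross d r0 = 0\<close>, one side of the monotonicity inequality
    vanishes, leaving the sign of \<open>cross d r\<close>.\<close>
  have neg: "cross d r < 0" if "0 < r" "r < r0" for r
    using cross_strict_mono[OF assms that] r0(3) pos by (simp add: mult_less_0_iff)
  have "0 < cross d r" if "r0 < r" for r
    using cross_strict_mono[OF assms pos that] r0(3) pos by (simp add: zero_less_mult_iff)
  then show ?thesis using strict r0(3) pos neg by (intro exI[of _ r0]) (auto simp: field_simps)
qed

lemma U2_pos: "0 < U2 d r" if "0 \<le> d" "0 < r"
  unfolding U2_def using that by (intro add_pos_nonneg add_nonneg_nonneg mult_nonneg_nonneg mult_pos_pos) auto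

lemma V2_pos: "0 < V2 d r" if "0 \<le> d" "0 < r"
  unfolding V2_def using that by (intro add_pos_nonneg add_nonneg_nonneg mult_nonneg_nonneg) auto

lemma quotient_diff_eq_cross:
  assumes "0 \<le> d" "0 < r"
  shows "V1 d r / V2 d r - U1 d r / U2 d r = cross d r * (r / (37800 * V2 d r * U2 d r))"
  using cross_eq[of d r] U2_pos[OF assms] V2_pos[OF assms] by (simp add: field_simps)

lemma quotient_difference_sign_change:
  assumes "3 \<le> d"
  shows "\<exists>r0. 0.4 * d^2 - 1 < r0 \<and> r0 < 0.42 * d^2 + 2 \<and> 0 < r0 \<and>
    V1 d r0 / V2 d r0 - U1 d r0 / U2 d r0 = 0 \<and>
    (\<forall>r. 0 < r \<and> r < r0 \<longrightarrow> V1 d r / V2 d r < U1 d r / U2 d r) \<and>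
    (\<forall>r. r0 < r \<longrightarrow> U1 d r / U2 d r < V1 d r / V2 d r)"
proof -
  obtain r0 where r0: "0.4 * d^2 - 1 < r0" "r0 < 0.42 * d^2 + 2" "0 < r0" "cross d r0 = 0"
    "\<And>r. 0 < r \<Longrightarrow> r < r0 \<Longrightarrow> cross d r < 0" "\<And>r. r0 < r \<Longrightarrow> 0 < cross d r"
    using cross_has_root[OF assms] by blast
  have d: "0 \<le> d" using assms by simp
  have pos: "0 < r / (37800 * V2 d r * U2 d r)" if "0 < r" for r
    using U2_pos[OF d that] V2_pos[OF d that] that by simp
  have "V1 d r / V2 d r < U1 d r / U2 d r" if "0 < r" "r < r0" for r
    using mult_neg_pos[OF r0(5)[OF that] pos[OF that(1)]] quotient_diff_eq_cross[OF d that(1)] by linarith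
  moreover have "U1 d r / U2 d r < V1 d r / V2 d r" if "r0 < r" for r
  proof -
    have r: "0 < r" using that r0(3) by simp
    show ?thesis using mult_pos_pos[OF r0(6)[OF that] pos[OF r]] quotient_diff_eq_cross[OF d r] by linarith
  qed
  moreover have "V1 d r0 / V2 d r0 - U1 d r0 / U2 d r0 = 0"
    using quotient_diff_eq_cross[OF d r0(3)] r0(4) by simp
  ultimately show ?thesis using r0(1-3) by blast
qed

section \<open>Brooms\<close>

primrec descent :: "nat \<Rightarrow> (nat \<times> nat) list" where
  "descent 0 = []"
| "descent (Suc k) = (Suc k, k) # descent k"

definition broom_path :: "nat \<Rightarrow> nat \<Rightarrow> (nat \<times> nat) list" where
  "broom_path d i = (if i < d then descent i else [(i, 0)])"

definition broom_path_verts :: "nat \<Rightarrow> nat \<Rightarrow> nat set" where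
  "broom_path_verts d i = (if i < d then {..i} else {0, i})"

lemma pawalk_verts_descent: "set (pawalk_verts i (descent i)) = {..i}"
  by (induction i) auto

lemma pawalk_verts_broom_path: "set (pawalk_verts i (broom_path d i)) = broom_path_verts d i"
  by (auto simp: broom_path_def broom_path_verts_def pawalk_verts_descent)

lemma parcs_broom_iff:
  "(i, j) \<in> parcs (broom d r) \<longleftrightarrow>
    i < d \<and> j < d \<and> (j = Suc i \<or> i = Suc j) \<or> i = 0 \<and> d \<le> j \<and> j < d + r \<or> j = 0 \<and> d \<le> i \<and> i < d + r"
  by (auto simp: broom_def)

lemma pair_wf_digraph_broom: "1 \<le> d \<Longrightarrow> pair_wf_digraph (broom d r)"
  by unfold_locales (auto simp: broom_def)

lemma apath_broom_path:
  assumes "1 \<le> d" "i < d + r"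
  shows "pre_digraph.apath (with_proj (broom d r)) i (broom_path d i) 0"
proof -
  interpret pair_wf_digraph "broom d r" using assms(1) by (rule pair_wf_digraph_broom)
  have V: "pverts (broom d r) = {0..<d + r}" by (simp add: broom_def)
  have "apath i (descent i) 0" if "i < d" for i
    using that
  proof (induction i)
    case 0
    then show ?case using assms by (simp add: apath_Nil_iff V)
  next
    case (Suc i)
    then show ?case by (auto simp: apath_Cons_iff parcs_broom_iff pawalk_verts_descent)
  qed
  then show ?thesis
    using assms by (auto simp: broom_path_def apath_Cons_iff apath_Nil_iff V parcs_broom_iff)
qed

text \<open>By induction the path continues canonically from its second vertex \<open>j\<close>. An
  arc leading away from the root would put \<open>i\<close> on that canonical path, so the first arc
  leads towards the root.\<close>

lemma apath_broom_unique:
  assumes "1 \<le> d" "pre_digraph.apath (with_proj (broom d r)) i p 0"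
  shows "p = broom_path d i"
proof -
  interpret pair_wf_digraph "broom d r" using assms(1) by (rule pair_wf_digraph_broom)
  from assms(2) show ?thesis
  proof (induction p arbitrary: i)
    case Nil
    then show ?case using assms(1) by (simp add: apath_Nil_iff broom_path_def)
  next
    case (Cons e p)
    obtain j where e: "e = (i, j)" and arc: "(i, j) \<in> parcs (broom d r)"
      and p: "apath j p 0" and i: "i \<notin> set (pawalk_verts j p)"
      using Cons.prems by (cases e) (auto simp: apath_Cons_iff)
    have peq: "p = broom_path d j" using Cons.IH p by blast
    have "i \<noteq> 0" using apath_nonempty_ends[OF Cons.prems] by simp
    moreover have "i \<notin> broom_path_verts d j"
      using i unfolding peq pawalk_verts_broom_path .
    ultimately show ?case
      using arc assms(1) unfolding e peq parcs_broom_iff by (auto simp: broom_path_def broom_path_verts_def)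
  qed
qed

lemma path_verts_broom:
  assumes "1 \<le> d" "i < d + r"
  shows "path_verts (broom d r) i 0 = broom_path_verts d i"
  using path_verts_eq[OF apath_broom_path[OF assms] apath_broom_unique[OF assms(1)]]
  by (simp add: pawalk_verts_broom_path)

text \<open>The path matrix of the broom, the same for every \<open>r\<close>: each index from
  \<open>d\<close> on is a pendent vertex, and the ranges of the sums truncate it.\<close>

definition broom_mat :: "nat \<Rightarrow> nat \<Rightarrow> nat \<Rightarrow> real" where
  "broom_mat d i j = (if i \<in> broom_path_verts d j then 1 else 0)"

lemma gram_broom_mat:
  assumes "i < n" "j < n"
  shows "gram n (broom_mat d) i j = real (card (broom_path_verts d i \<inter> broom_path_verts d j))"
proof -
  have "broom_path_verts d i \<subseteq> {..<n}" using assms by (auto simp: broom_path_verts_def split: if_splits)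
  then have "{..<n} \<inter> {k. k \<in> broom_path_verts d i \<and> k \<in> broom_path_verts d j} =
    broom_path_verts d i \<inter> broom_path_verts d j" by auto
  moreover have "gram n (broom_mat d) i j =
    (\<Sum>k<n. if k \<in> broom_path_verts d i \<and> k \<in> broom_path_verts d j then 1 else 0)"
    unfolding gram_def broom_mat_def by (rule sum.cong) auto
  ultimately show ?thesis by (simp flip: sum.inter_filter add: Int_def)
qed

lemma M1_eq_gram:
  assumes "1 \<le> d"
  shows "M1 d r = mat (d + r) (d + r) (\<lambda>(i, j). gram (d + r) (broom_mat d) i j)"
  unfolding M1_def bottleneck_mat_def
  by (rule eq_matI) (auto simp: path_verts_broom[OF assms] gram_broom_mat)

lemma Q1_eq_gram:
  assumes "1 \<le> d"
  shows "Q1 d r = mat (d + r) (d + r) (\<lambda>(i, j). gram (d + r) (tr (broom_mat d)) i j)"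
proof -
  have N: "path_mat (d + r) (broom d r) 0 = mat (d + r) (d + r) (\<lambda>(i, j). broom_mat d i j)"
    unfolding path_mat_def by (rule eq_matI) (auto simp: path_verts_broom[OF assms] broom_mat_def)
  show ?thesis
    unfolding Q1_def neckbottle_mat_def N
    by (rule eq_matI) (auto simp: gram_def scalar_prod_def lessThan_atLeast0 intro!: sum.cong)
qed

lemma c3_eq_mom:
  "c3 (mat n n (\<lambda>(i, j). gram n A i j)) (ones n) = mom n A 3 / mom n A 2"
  unfolding c3_eq_dot mom_def ..

section \<open>The path matrix of the broom acting on vectors\<close>

lemma mv_cong: "(\<And>i. i < n \<Longrightarrow> f i = g i) \<Longrightarrow> mv n A f = mv n A g"
  unfolding mv_def by (intro ext sum.cong) auto

lemma dot_cong: "(\<And>i. i < n \<Longrightarrow> f i = f' i) \<Longrightarrow> (\<And>i. i < n \<Longrightarrow> g i = g' i) \<Longrightarrow> dot n f g = dot n f' g'"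
  unfolding dot_def by (intro sum.cong) auto

text \<open>By symmetry, N and N^T preserve the vectors that are constant on the pendent vertices,
  so every iterate of the all-ones vector has this form.\<close>

definition bfun :: "nat \<Rightarrow> (nat \<Rightarrow> real) \<Rightarrow> real \<Rightarrow> nat \<Rightarrow> real" where
  "bfun d g p i = (if i < d then g i else p)"

lemma sum_lessThan_add: "(\<Sum>j<d + r. f j) = (\<Sum>j<d. f j) + (\<Sum>j\<in>{d..<d + r}. f j)" for f :: "nat \<Rightarrow> real"
  using sum.atLeastLessThan_concat[of 0 d "d + r" f] by (simp add: lessThan_atLeast0)

lemma sum_bfun: "(\<Sum>j<d + r. bfun d g p j) = (\<Sum>j<d. g j) + real r * p"
  unfolding sum_lessThan_add by (simp add: bfun_def)

lemma dot_bfun: "dot (d + r) (bfun d g p) (bfun d h q) = (\<Sum>i<d. g i * h i) + real r * (p * q)"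
proof -
  have "dot (d + r) (bfun d g p) (bfun d h q) = (\<Sum>i<d + r. bfun d (\<lambda>i. g i * h i) (p * q) i)"
    unfolding dot_def by (rule sum.cong) (auto simp: bfun_def)
  then show ?thesis by (simp add: sum_bfun)
qed

text \<open>N sums over descendants: tail sums along the path, with the pendent vertices
  contributing only at the root. Tails appear as differences of prefix sums, whose closed forms
  follow by plain induction.\<close>

lemma mv_broom_bfun:
  assumes "1 \<le> d" "i < d + r"
  shows "mv (d + r) (broom_mat d) (bfun d g p) i =
    bfun d (\<lambda>i. (\<Sum>j<d. g j) - (\<Sum>j<i. g j) + (if i = 0 then real r * p else 0)) p i"
proof -
  have mv: "mv (d + r) (broom_mat d) (bfun d g p) i =
      (\<Sum>j<d. broom_mat d i j * g j) + (\<Sum>j\<in>{d..<d + r}. broom_mat d i j * p)"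
    unfolding mv_apply sum_lessThan_add by (simp add: bfun_def)
  consider "i = 0" | "0 < i" "i < d" | "d \<le> i" by linarith
  then show ?thesis
  proof cases
    case 1
    then show ?thesis unfolding mv using assms by (simp add: broom_mat_def broom_path_verts_def bfun_def)
  next
    case 2
    have "(\<Sum>j<d. broom_mat d i j * g j) = (\<Sum>j<d. if i \<le> j then g j else 0)"
      by (rule sum.cong) (auto simp: broom_mat_def broom_path_verts_def)
    also have "\<dots> = (\<Sum>j\<in>{i..<d}. g j)"
      by (rule sum.mono_neutral_cong_right) auto
    also have "\<dots> = (\<Sum>j<d. g j) - (\<Sum>j<i. g j)"
      using sum.atLeastLessThan_concat[of 0 i d g] 2 by (simp add: lessThan_atLeast0)
    finally show ?thesis unfolding mv using 2 by (simp add: broom_mat_def broom_path_verts_def bfun_def)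
  next
    case 3
    have "(\<Sum>j<d. broom_mat d i j * g j) = 0"
      using 3 by (intro sum.neutral) (auto simp: broom_mat_def broom_path_verts_def)
    moreover have "(\<Sum>j\<in>{d..<d + r}. broom_mat d i j * p) = (\<Sum>j\<in>{d..<d + r}. if j = i then p else 0)"
      using 3 assms by (intro sum.cong) (auto simp: broom_mat_def broom_path_verts_def)
    ultimately show ?thesis unfolding mv using 3 assms by (simp add: bfun_def)
  qed
qed

lemma mv_tr_broom_bfun:
  assumes "1 \<le> d" "j < d + r"
  shows "mv (d + r) (tr (broom_mat d)) (bfun d g p) j = bfun d (\<lambda>j. \<Sum>i<Suc j. g i) (g 0 + p) j"
proof (cases "j < d")
  case True
  have "mv (d + r) (tr (broom_mat d)) (bfun d g p) j = (\<Sum>i<d + r. if i < Suc j then g i else 0)"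
    unfolding mv_apply using True by (intro sum.cong) (auto simp: broom_mat_def broom_path_verts_def bfun_def)
  also have "\<dots> = (\<Sum>i<Suc j. g i)"
    using assms by (intro sum.mono_neutral_cong_right) auto
  finally show ?thesis using True by (simp add: bfun_def)
next
  case False
  have "mv (d + r) (tr (broom_mat d)) (bfun d g p) j =
      (\<Sum>i<d + r. (if i = 0 then g 0 else 0) + (if i = j then p else 0))"
    unfolding mv_apply using False assms
    by (intro sum.cong) (auto simp: broom_mat_def broom_path_verts_def bfun_def)
  also have "\<dots> = g 0 + p" using False assms by (simp add: sum.distrib)
  finally show ?thesis using False by (simp add: bfun_def)
qed

text \<open>Moments as squared norms: two or three matrix applications are enough.\<close>

lemma mom_2: "mom n A 2 = dot n (mv n (tr A) (mv n A (\<lambda>_. 1))) (mv n (tr A) (mv n A (\<lambda>_. 1)))"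
  using dot_it[where n = n and A = A and i = 1 and j = 1] by (simp add: mv_gram numeral_2_eq_2)

lemma mom_3: "mom n A 3 =
  dot n (mv n A (mv n (tr A) (mv n A (\<lambda>_. 1)))) (mv n A (mv n (tr A) (mv n A (\<lambda>_. 1))))"
  using dot_mv_it[where n = n and A = A and i = 1 and j = 1] by (simp only: numeral_3_eq_3 funpow.simps mv_gram One_nat_def o_apply id_apply add_Suc add_0)

lemma bfun_const: "bfun d (\<lambda>_. 1) 1 = (\<lambda>_. 1)"
  by (simp add: bfun_def fun_eq_iff)

section \<open>Power sums and closed forms of the moments\<close>

lemma sum_powers:
  "(\<Sum>i<m. real i) = real m * (real m - 1) / 2"
  "(\<Sum>i<m. real i ^ 2) = real m * (real m - 1) * (2 * real m - 1) / 6"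
  "(\<Sum>i<m. real i ^ 3) = (real m * (real m - 1) / 2)^2"
  "(\<Sum>i<m. real i ^ 4) = real m * (real m - 1) * (2 * real m - 1) * (3 * real m ^ 2 - 3 * real m - 1) / 30"
  "(\<Sum>i<m. real i ^ 5) = (real m * (real m - 1))^2 * (2 * real m ^ 2 - 2 * real m - 1) / 12"
  "(\<Sum>i<m. real i ^ 6) = real m * (real m - 1) * (2 * real m - 1) *
      (3 * real m ^ 4 - 6 * real m ^ 3 + 3 * real m + 1) / 42"
  by (induction m) (simp_all add: field_simps eval_nat_numeral)

text \<open>Three partial summations of the constant 1 give a cubic in the index, whose square has
  degree 6. This is the sum of that square over the indices below \<open>m\<close>.\<close>

definition cubic_square_sum :: "real \<Rightarrow> real \<Rightarrow> real \<Rightarrow> real \<Rightarrow> real \<Rightarrow> real" where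
  "cubic_square_sum a0 a1 a2 a3 m =
     a0^2 * m + 2 * a0 * a1 * (m * (m - 1) / 2) + (2 * a0 * a2 + a1^2) * (m * (m - 1) * (2 * m - 1) / 6)
     + (2 * a0 * a3 + 2 * a1 * a2) * (m * (m - 1) / 2)^2
     + (2 * a1 * a3 + a2^2) * (m * (m - 1) * (2 * m - 1) * (3 * m^2 - 3 * m - 1) / 30)
     + 2 * a2 * a3 * ((m * (m - 1))^2 * (2 * m^2 - 2 * m - 1) / 12)
     + a3^2 * (m * (m - 1) * (2 * m - 1) * (3 * m^4 - 6 * m^3 + 3 * m + 1) / 42)"

lemma sum_cubic_square:
  "(\<Sum>i<m. (a0 + a1 * real i + a2 * real i ^ 2 + a3 * real i ^ 3)^2) = cubic_square_sum a0 a1 a2 a3 (real m)"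
proof -
  have "(a0 + a1 * real i + a2 * real i ^ 2 + a3 * real i ^ 3)^2 =
      a0^2 + 2 * a0 * a1 * real i + (2 * a0 * a2 + a1^2) * real i ^ 2
      + (2 * a0 * a3 + 2 * a1 * a2) * real i ^ 3 + (2 * a1 * a3 + a2^2) * real i ^ 4
      + 2 * a2 * a3 * real i ^ 5 + a3^2 * real i ^ 6" for i
    by (simp add: algebra_simps eval_nat_numeral)
  then show ?thesis
    by (simp only: sum.distrib sum_distrib_left[symmetric] sum_powers sum_constant card_lessThan
        cubic_square_sum_def mult.commute[of "a0^2"])
qed

text \<open>The root collects the contributions of the pendent vertices, so there the entry deviates
  from the polynomial by \<open>x\<close>.\<close>

lemma sum_power2_add_at_0:
  fixes f :: "nat \<Rightarrow> real"
  assumes "1 \<le> d"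
  shows "(\<Sum>i<d. (f i + (if i = 0 then x else 0))^2) = (\<Sum>i<d. (f i)^2) + 2 * x * f 0 + x^2"
proof -
  have "(\<Sum>i<d. (f i + (if i = 0 then x else 0))^2) = (\<Sum>i<d. (f i)^2 + (if i = 0 then 2 * x * f 0 + x^2 else 0))"
    by (rule sum.cong) (auto simp: power2_eq_square algebra_simps)
  then show ?thesis using assms by (simp add: sum.distrib)
qed

text \<open>The entries are quadratic in the index; the zero cubic terms are kept to match
  \<open>sum_cubic_square\<close>.\<close>

lemma broom_row_sums:
  assumes "1 \<le> d"
  shows "i < d + r \<Longrightarrow> mv (d + r) (tr (broom_mat d)) (mv (d + r) (broom_mat d) (\<lambda>_. 1)) i =
      bfun d (\<lambda>j. (real d + real r) + (real d - 1/2) * real j + (-1/2) * real j ^ 2 + 0 * real j ^ 3)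
        (real d + real r + 1) i" (is "_ \<Longrightarrow> ?MM i = bfun d ?m ?mp i")
    and "i < d + r \<Longrightarrow> mv (d + r) (broom_mat d) (mv (d + r) (tr (broom_mat d)) (\<lambda>_. 1)) i =
      bfun d (\<lambda>j. (real d * (real d + 1) / 2 + (-1/2) * real j + (-1/2) * real j ^ 2 + 0 * real j ^ 3)
          + (if j = 0 then 2 * real r else 0)) 2 i" (is "_ \<Longrightarrow> ?QQ i = bfun d ?q ?qp i")
proof -
  let ?N = "broom_mat d" and ?n = "d + r"
  \<comment> \<open>The number of descendants of the path vertex \<open>i\<close>, itself
    included.\<close>
  define g where "g i = real d - real i + (if i = 0 then real r else 0)" for i
  have "mv ?n ?N (\<lambda>_. 1) i = bfun d g 1 i" if "i < ?n" for i
    using mv_broom_bfun[OF assms that, of "\<lambda>_. 1" 1] unfolding bfun_const by (simp add: bfun_def g_def)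
  then have "mv ?n (tr ?N) (mv ?n ?N (\<lambda>_. 1)) = mv ?n (tr ?N) (bfun d g 1)" by (rule mv_cong)
  moreover have "(\<Sum>i<Suc j. g i) = ?m j" for j
    by (induction j) (simp_all add: g_def field_simps power2_eq_square)
  ultimately show "i < ?n \<Longrightarrow> ?MM i = bfun d ?m ?mp i"
    by (simp only: mv_tr_broom_bfun[OF assms]) (simp add: bfun_def g_def)
  have "mv ?n (tr ?N) (\<lambda>_. 1) i = bfun d (\<lambda>j. real j + 1) 2 i" if "i < ?n" for i
    using mv_tr_broom_bfun[OF assms that, of "\<lambda>_. 1" 1] unfolding bfun_const by (simp add: bfun_def)
  then have "mv ?n ?N (mv ?n (tr ?N) (\<lambda>_. 1)) = mv ?n ?N (bfun d (\<lambda>j. real j + 1) 2)" by (rule mv_cong)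
  moreover have "(\<Sum>i<j. real i + 1) = real j * (real j + 1) / 2" for j
    by (induction j) (simp_all add: field_simps)
  ultimately show "i < ?n \<Longrightarrow> ?QQ i = bfun d ?q ?qp i"
    by (simp only: mv_broom_bfun[OF assms]) (simp add: bfun_def field_simps power2_eq_square)
qed

lemma mom_broom:
  assumes "1 \<le> d"
  shows "mom (d + r) (broom_mat d) 2 =
      cubic_square_sum (real d + real r) (real d - 1/2) (-1/2) 0 (real d) + real r * (real d + real r + 1)^2" (is ?M2)
    and "mom (d + r) (broom_mat d) 3 =
      (let a = real d * (real d * (real d + 1) / 2 + real r) - (real d ^ 3 - real d) / 6; x = real r * (real d + real r + 1)
       in cubic_square_sum a (- (real d / 2 + 1/6 + real r)) (- real d / 2) (1/6) (real d)
          + 2 * x * a + x^2 + real r * (real d + real r + 1)^2)" (is ?M3)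
    and "mom (d + r) (tr (broom_mat d)) 2 =
      cubic_square_sum (real d * (real d + 1) / 2) (-1/2) (-1/2) 0 (real d)
        + 2 * (2 * real r) * (real d * (real d + 1) / 2) + (2 * real r)^2 + 4 * real r" (is ?Q2)
    and "mom (d + r) (tr (broom_mat d)) 3 =
      cubic_square_sum (real d * (real d + 1) / 2 + 2 * real r) (real d * (real d + 1) / 2 - 1/3) (-1/2) (-1/6) (real d)
        + real r * (real d * (real d + 1) / 2 + 2 * real r + 2)^2" (is ?Q3)
proof -
  let ?N = "broom_mat d" and ?n = "d + r"
  \<comment> \<open>\<open>a\<close> sums the entries of N^T N 1 over the path, \<open>p\<close> is
    its entry at a pendent vertex, and \<open>x = r * p\<close> is what these vertices add at the
    root.\<close>
  define a x p where "a = real d * (real d * (real d + 1) / 2 + real r) - (real d ^ 3 - real d) / 6"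
    and "x = real r * (real d + real r + 1)" and "p = real d + real r + 1"
  let ?m = "\<lambda>j. (real d + real r) + (real d - 1/2) * real j + (-1/2) * real j ^ 2 + 0 * real j ^ 3"
  note M = broom_row_sums(1)[OF assms, of _ r, folded p_def]
  have "mom ?n ?N 2 = dot ?n (bfun d ?m p) (bfun d ?m p)" unfolding mom_2 by (intro dot_cong M)
  then show ?M2 unfolding dot_bfun power2_eq_square[symmetric] sum_cubic_square by (simp add: p_def)
  let ?m3 = "\<lambda>i. a + (- (real d / 2 + 1/6 + real r)) * real i + (- real d / 2) * real i ^ 2 + 1/6 * real i ^ 3"
  let ?m3' = "\<lambda>i. ?m3 i + (if i = 0 then x else 0)"
  have sum_m: "(\<Sum>j<i. ?m j) = real i * (real d * (real i + 1) / 2 + real r) - (real i ^ 3 - real i) / 6" for i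
    by (induction i) (simp_all add: field_simps power2_eq_square power3_eq_cube)
  have M3: "mv ?n ?N (mv ?n (tr ?N) (mv ?n ?N (\<lambda>_. 1))) i = bfun d ?m3' p i" if "i < ?n" for i
  proof -
    have "mv ?n ?N (mv ?n (tr ?N) (mv ?n ?N (\<lambda>_. 1))) = mv ?n ?N (bfun d ?m p)" by (rule mv_cong) (rule M)
    then show ?thesis
      using that by (simp only: mv_broom_bfun[OF assms] sum_m)
        (simp add: bfun_def a_def x_def p_def field_simps power2_eq_square power3_eq_cube)
  qed
  have "mom ?n ?N 3 = dot ?n (bfun d ?m3' p) (bfun d ?m3' p)" unfolding mom_3 by (intro dot_cong M3)
  then show ?M3
    unfolding dot_bfun power2_eq_square[symmetric] sum_power2_add_at_0[OF assms] sum_cubic_square Let_def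
    by (simp add: a_def x_def p_def)
  define b where "b = real d * (real d + 1) / 2"
  let ?q = "\<lambda>j. b + (-1/2) * real j + (-1/2) * real j ^ 2 + 0 * real j ^ 3"
  let ?q' = "\<lambda>j. ?q j + (if j = 0 then 2 * real r else 0)"
  note Q = broom_row_sums(2)[OF assms, of _ r, folded b_def]
  have "mom ?n (tr ?N) 2 = dot ?n (bfun d ?q' 2) (bfun d ?q' 2)" unfolding mom_2 by (intro dot_cong Q)
  then show ?Q2
    unfolding dot_bfun power2_eq_square[symmetric] sum_power2_add_at_0[OF assms] sum_cubic_square
    by (simp add: b_def)
  let ?q3 = "\<lambda>j. (b + 2 * real r) + (b - 1/3) * real j + (-1/2) * real j ^ 2 + (-1/6) * real j ^ 3"
  \<comment> \<open>Every prefix contains the root, so its extra \<open>2 * r\<close> moves into the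
    constant term and no exception at index 0 is left.\<close>
  have sum_q: "(\<Sum>i<Suc j. ?q' i) = ?q3 j" for j
    by (induction j) (simp_all add: field_simps power2_eq_square power3_eq_cube)
  have Q3: "mv ?n (tr ?N) (mv ?n ?N (mv ?n (tr ?N) (\<lambda>_. 1))) i = bfun d ?q3 (b + 2 * real r + 2) i"
    if "i < ?n" for i
  proof -
    have "mv ?n (tr ?N) (mv ?n ?N (mv ?n (tr ?N) (\<lambda>_. 1))) = mv ?n (tr ?N) (bfun d ?q' 2)"
      by (rule mv_cong) (rule Q)
    then show ?thesis using that by (simp only: mv_tr_broom_bfun[OF assms] sum_q) (simp add: bfun_def)
  qed
  have "mom ?n (tr ?N) 3 = dot ?n (bfun d ?q3 (b + 2 * real r + 2)) (bfun d ?q3 (b + 2 * real r + 2))"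
    unfolding mom_3 by (intro dot_cong Q3)
  then show ?Q3 unfolding dot_bfun power2_eq_square[symmetric] sum_cubic_square by (simp add: b_def)
qed

lemma mom_broom_eq_UV:
  assumes "1 \<le> d"
  shows "mom (d + r) (broom_mat d) 2 = V2 (real d) (real r)"
    and "mom (d + r) (broom_mat d) 3 = V1 (real d) (real r)"
    and "mom (d + r) (tr (broom_mat d)) 2 = U2 (real d) (real r)"
    and "mom (d + r) (tr (broom_mat d)) 3 = U1 (real d) (real r)"
  unfolding mom_broom[OF assms] Let_def cubic_square_sum_def U1_def U2_def V1_def V2_def
  by (simp_all add: field_simps eval_nat_numeral)

section \<open>Comparison of a rooted tree with its broom\<close>

text \<open>Back substitution from the last row. The broom is numbered so that the path of
  \<open>j\<close> to the root uses no index above \<open>j\<close>, which makes its path matrix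
  upper unitriangular.\<close>

lemma upper_unitriangular_inj:
  assumes "\<And>i. i < n \<Longrightarrow> A i i = 1" "\<And>i j. j < i \<Longrightarrow> A i j = 0"
    and "\<And>i. i < n \<Longrightarrow> mv n A f i = 0" "i < n"
  shows "f i = 0"
  using \<open>i < n\<close>
proof (induction "n - i" arbitrary: i rule: less_induct)
  case less
  have "A i j * f j = (if j = i then f i else 0)" if "j < n" for j
    using less that assms(1,2) by (cases j i rule: linorder_cases) auto
  then have "mv n A f i = (\<Sum>j<n. if j = i then f i else 0)" unfolding mv_apply by (intro sum.cong) auto
  then show ?case using assms(3)[OF less.prems] less.prems by simp
qed

lemma lower_unitriangular_inj:
  assumes "\<And>i. i < n \<Longrightarrow> A i i = 1" "\<And>i j. i < j \<Longrightarrow> A i j = 0"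
    and "\<And>i. i < n \<Longrightarrow> mv n A f i = 0" "i < n"
  shows "f i = 0"
  using \<open>i < n\<close>
proof (induction i rule: less_induct)
  case (less i)
  have "A i j * f j = (if j = i then f i else 0)" if "j < n" for j
    using less that assms(1,2) by (cases j i rule: linorder_cases) auto
  then have "mv n A f i = (\<Sum>j<n. if j = i then f i else 0)" unfolding mv_apply by (intro sum.cong) auto
  then show ?case using assms(3)[OF less.prems] less.prems by simp
qed

lemma ex_bij_betw_extending:
  fixes v :: "nat \<Rightarrow> nat"
  assumes "inj_on v {..<d}" "v ` {..<d} \<subseteq> {..<n}" "d \<le> n"
  shows "\<exists>s. bij_betw s {..<n} {..<n} \<and> (\<forall>i<d. s i = v i)"
proof -
  have "card ({..<n} - {..<d}) = card ({..<n} - v ` {..<d})"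
    using assms by (simp add: card_Diff_subset card_image)
  then obtain g where g: "bij_betw g ({..<n} - {..<d}) ({..<n} - v ` {..<d})"
    using finite_same_card_bij[of "{..<n} - {..<d}" "{..<n} - v ` {..<d}"] by auto
  let ?s = "\<lambda>i. if i < d then v i else g i"
  have "bij_betw ?s {..<d} (v ` {..<d})"
    using assms(1) by (auto simp: bij_betw_def inj_on_def)
  moreover have "bij_betw ?s ({..<n} - {..<d}) ({..<n} - v ` {..<d})"
    using g by (rule bij_betw_cong[THEN iffD1, rotated]) auto
  ultimately have "bij_betw ?s ({..<d} \<union> ({..<n} - {..<d})) (v ` {..<d} \<union> ({..<n} - v ` {..<d}))"
    by (rule bij_betw_combine) auto
  moreover have "{..<d} \<union> ({..<n} - {..<d}) = {..<n}" using assms(3) by auto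
  moreover have "v ` {..<d} \<union> ({..<n} - v ` {..<d}) = {..<n}" using assms(2) by auto
  ultimately have "bij_betw ?s {..<n} {..<n}" by simp
  then show ?thesis by (intro exI[of _ ?s]) auto
qed

text \<open>The path of the broom is sent to the first \<open>d\<close> vertices of a longest path from the root.\<close>

lemma rooted_tree_dominates_broom:
  assumes "rooted_tree n G x" "2 \<le> n" "eccentricity G x = ereal (real d)"
  shows "d < n" "\<exists>s. bij_betw s {..<n} {..<n} \<and>
    (\<forall>i<n. \<forall>j<n. card (broom_path_verts d i \<inter> broom_path_verts d j)
      \<le> card (path_verts G (s i) x \<inter> path_verts G (s j) x))"
proof -
  interpret pair_graph G using assms(1) by (rule rooted_treeD)
  obtain u p where p: "apath u p x" "d \<le> length p" and d: "1 \<le> d"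
    using rooted_tree_eccentricity[OF assms] by blast
  define vs where "vs = pawalk_verts u p"
  have w: "awalk u p x" and dist: "distinct vs" using p(1) by (auto simp: apath_def vs_def)
  have len: "length vs = Suc (length p)" unfolding vs_def by (rule length_awalk_verts)
  have "u < n" using awalk_hd_in_verts[OF w] rooted_treeD(2)[OF assms(1)] by simp
  from rooted_tree_ends_in_path_verts(3)[OF assms(1) this] have vs_n: "set vs \<subseteq> {..<n}"
    unfolding rooted_tree_path_verts[OF assms(1) p(1)] vs_def[symmetric] by (simp add: lessThan_atLeast0)
  have lastv: "vs ! length p = x"
    using w last_conv_nth[of vs] len by (auto simp: vs_def)
  show dn: "d < n" using length_apath_less[OF p(1)] p(2) rooted_treeD(2)[OF assms(1)] by simp
  \<comment> \<open>The walk ends at the root, so counting backwards makes \<open>v a\<close> the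
    vertex \<open>a\<close> steps from it.\<close>
  define v where "v a = vs ! (length p - a)" for a
  have inj: "inj_on v {..<d}"
    using dist len p(2) by (auto simp: inj_on_def v_def nth_eq_iff_index_eq)
  have "v ` {..<d} \<subseteq> {..<n}"
  proof (rule image_subsetI)
    fix a
    have "v a \<in> set vs" unfolding v_def using len by (intro nth_mem) simp
    then show "v a \<in> {..<n}" using vs_n by blast
  qed
  then obtain s where s: "bij_betw s {..<n} {..<n}" "\<And>i. i < d \<Longrightarrow> s i = v i"
    using ex_bij_betw_extending[OF inj] dn by (metis less_imp_le)
  have v_in: "v b \<in> path_verts G (v a) x" if "b \<le> a" "a < d" for a b
  proof -
    have "path_verts G (v a) x = set (drop (length p - a) vs)"
      using rooted_tree_path_verts_suffix[OF assms(1) p(1), of "length p - a"] by (simp add: v_def vs_def)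
    moreover have "v b = drop (length p - a) vs ! (a - b)"
      using that p(2) len by (simp add: v_def)
    moreover have "a - b < length (drop (length p - a) vs)" using that p(2) len by simp
    ultimately show ?thesis by (metis nth_mem)
  qed
  \<comment> \<open>Along the path, everything between \<open>v a\<close> and the root lies on the
    path of \<open>v a\<close>. For the other vertices the root and the vertex itself are enough.
    Injectivity of \<open>s\<close> then carries this over to cardinalities of
    intersections.\<close>
  have sub: "s ` broom_path_verts d i \<subseteq> path_verts G (s i) x" if "i < n" for i
  proof (cases "i < d")
    case True
    then show ?thesis using v_in[of _ i] s(2) by (auto simp: broom_path_verts_def)
  next
    case False
    have "s i < n" using s(1) that by (auto simp: bij_betw_def)
    moreover have "s 0 = x" using s(2)[of 0] d lastv by (simp add: v_def)
    ultimately show ?thesis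
      using rooted_tree_ends_in_path_verts[OF assms(1), of "s i"] False by (auto simp: broom_path_verts_def)
  qed
  have "card (broom_path_verts d i \<inter> broom_path_verts d j)
      \<le> card (path_verts G (s i) x \<inter> path_verts G (s j) x)" if "i < n" "j < n" for i j
  proof -
    have "broom_path_verts d i \<inter> broom_path_verts d j \<subseteq> {..<n}"
      using that by (auto simp: broom_path_verts_def split: if_splits)
    then have "inj_on s (broom_path_verts d i \<inter> broom_path_verts d j)"
      using s(1) by (auto simp: bij_betw_def intro: inj_on_subset)
    then have "card (broom_path_verts d i \<inter> broom_path_verts d j)
        = card (s ` (broom_path_verts d i \<inter> broom_path_verts d j))"
      by (rule card_image[symmetric])
    also have "\<dots> \<le> card (path_verts G (s i) x \<inter> path_verts G (s j) x)"
    proof (rule card_mono)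
      have "s i < n" using s(1) that by (auto simp: bij_betw_def)
      then show "finite (path_verts G (s i) x \<inter> path_verts G (s j) x)"
        using rooted_tree_ends_in_path_verts(3)[OF assms(1)] finite_subset by blast
      show "s ` (broom_path_verts d i \<inter> broom_path_verts d j) \<subseteq> path_verts G (s i) x \<inter> path_verts G (s j) x"
        using sub that by blast
    qed
    finally show ?thesis .
  qed
  then show "\<exists>s. bij_betw s {..<n} {..<n} \<and>
    (\<forall>i<n. \<forall>j<n. card (broom_path_verts d i \<inter> broom_path_verts d j)
      \<le> card (path_verts G (s i) x \<inter> path_verts G (s j) x))" using s(1) by blast
qed

lemma broom_row_sums_not_const:
  assumes "1 \<le> d" "1 \<le> r"
  shows "mv (d + r) (gram (d + r) (broom_mat d)) (\<lambda>_. 1) 0 \<noteq> mv (d + r) (gram (d + r) (broom_mat d)) (\<lambda>_. 1) d"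
    and "mv (d + r) (gram (d + r) (tr (broom_mat d))) (\<lambda>_. 1) 0 \<noteq>
      mv (d + r) (gram (d + r) (tr (broom_mat d))) (\<lambda>_. 1) d"
proof -
  show "mv (d + r) (gram (d + r) (broom_mat d)) (\<lambda>_. 1) 0 \<noteq> mv (d + r) (gram (d + r) (broom_mat d)) (\<lambda>_. 1) d"
    using assms broom_row_sums(1)[of d 0 r] broom_row_sums(1)[of d d r]
    by (simp add: mv_gram bfun_def)
  \<comment> \<open>The row sum is d(d+1)/2 + 2r \<ge> 3 at the root and 2 at a pendent vertex; the
    bound on \<open>d * d\<close> makes the comparison linear.\<close>
  have "1 * 1 \<le> real d * real d" using assms by (intro mult_mono) auto
  then show "mv (d + r) (gram (d + r) (tr (broom_mat d))) (\<lambda>_. 1) 0 \<noteq>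
      mv (d + r) (gram (d + r) (tr (broom_mat d))) (\<lambda>_. 1) d"
    using assms broom_row_sums(2)[of d 0 r] broom_row_sums(2)[of d d r]
    by (simp add: mv_gram bfun_def field_simps)
qed

lemma c3_broom_less_rho:
  assumes "rooted_tree n G x" "2 \<le> n" "eccentricity G x = ereal (real d)" "r = n - d"
  shows "c3 (Q1 d r) (ones n) < rho (bottleneck_mat n G x)"
    and "c3 (M1 d r) (ones n) < rho (bottleneck_mat n G x)"
proof -
  have d: "1 \<le> d" by (rule rooted_tree_eccentricity(2)[OF assms(1-3)])
  have "d < n" by (rule rooted_tree_dominates_broom(1)[OF assms(1-3)])
  then have n: "n = d + r" "1 \<le> r" using assms(4) by auto
  obtain s where s: "bij_betw s {..<n} {..<n}"
    "\<And>i j. i < n \<Longrightarrow> j < n \<Longrightarrow> card (broom_path_verts d i \<inter> broom_path_verts d j)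
      \<le> card (path_verts G (s i) x \<inter> path_verts G (s j) x)"
    using rooted_tree_dominates_broom(2)[OF assms(1-3)] by blast
  let ?B = "\<lambda>i j. real (card (path_verts G i x \<inter> path_verts G j x))"
  have N: "0 \<le> broom_mat d i j \<and> broom_mat d i j \<le> 1" "broom_mat d i i = 1" "j < i \<Longrightarrow> broom_mat d i j = 0" for i j
    using d by (auto simp: broom_mat_def broom_path_verts_def)
  have less: "mom n (broom_mat d) 3 / mom n (broom_mat d) 2 < rho (mat n n (\<lambda>(i, j). ?B i j))"
    "mom n (tr (broom_mat d)) 3 / mom n (tr (broom_mat d)) 2 < rho (mat n n (\<lambda>(i, j). ?B i j))"
  proof (atomize (full), intro conjI)
    have inj: "f i = 0" if "\<And>i. i < n \<Longrightarrow> mv n (broom_mat d) f i = 0" "i < n" for f i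
      using upper_unitriangular_inj[of n "broom_mat d" f i] N(2,3) that by blast
    have inj': "f i = 0" if "\<And>i. i < n \<Longrightarrow> mv n (tr (broom_mat d)) f i = 0" "i < n" for f i
      using lower_unitriangular_inj[of n "tr (broom_mat d)" f i] N(2,3) that by blast
    have dom: "gram n (broom_mat d) i j \<le> ?B (s i) (s j)" if "i < n" "j < n" for i j
      using s(2)[OF that] gram_broom_mat[OF that] by simp
    have n0: "0 < n" "d < n" using n by auto
    have N1: "0 \<le> broom_mat d i j \<and> broom_mat d i j \<le> 1" if "i < n" "j < n" for i j by (rule N(1))
    have N2: "broom_mat d i i = 1" if "i < n" for i by (rule N(2))
    \<comment> \<open>The unequal row sums are those of the root 0 and of the pendent vertex
      \<open>d\<close>, which exists because r \<ge> 1.\<close>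
    note facts = c3_gram_less_rho[where A = "broom_mat d" and n = n and s = s and B = ?B and i = 0 and j = d
        and i' = 0 and j' = d]
    show "mom n (broom_mat d) 3 / mom n (broom_mat d) 2 < rho (mat n n (\<lambda>(i, j). ?B i j))"
      by (rule facts(1)) (fact N1 N2 n0 s(1) dom inj inj' broom_row_sums_not_const[OF d n(2), folded n(1)])+
    show "mom n (tr (broom_mat d)) 3 / mom n (tr (broom_mat d)) 2 < rho (mat n n (\<lambda>(i, j). ?B i j))"
      by (rule facts(2)) (fact N1 N2 n0 s(1) dom inj inj' broom_row_sums_not_const[OF d n(2), folded n(1)])+
  qed
  show "c3 (Q1 d r) (ones n) < rho (bottleneck_mat n G x)"
    using less(2) unfolding Q1_eq_gram[OF d] n(1)[symmetric] c3_eq_mom bottleneck_mat_def .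
  show "c3 (M1 d r) (ones n) < rho (bottleneck_mat n G x)"
    using less(1) unfolding M1_eq_gram[OF d] n(1)[symmetric] c3_eq_mom bottleneck_mat_def .
qed

lemma c3_broom:
  assumes "1 \<le> d"
  shows "c3 (Q1 d r) (ones (d + r)) = U1 (real d) (real r) / U2 (real d) (real r)"
    and "c3 (M1 d r) (ones (d + r)) = V1 (real d) (real r) / V2 (real d) (real r)"
  unfolding Q1_eq_gram[OF assms] M1_eq_gram[OF assms] c3_eq_mom mom_broom_eq_UV[OF assms] by simp_all

theorem theorem3p7:
  shows
    "(\<forall>n G x d r. rooted_tree n G x \<and> 2 \<le> n \<and> eccentricity G x = ereal (real d) \<and> r = n - d \<longrightarrow>
        c3 (Q1 d r) (ones n) < rho (bottleneck_mat n G x) \<and>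
        c3 (M1 d r) (ones n) < rho (bottleneck_mat n G x))
   \<and> (\<forall>d r. 1 \<le> d \<and> 1 \<le> r \<longrightarrow>
        c3 (Q1 d r) (ones (d + r)) = U1 (real d) (real r) / U2 (real d) (real r) \<and>
        c3 (M1 d r) (ones (d + r)) = V1 (real d) (real r) / V2 (real d) (real r))
   \<and> (\<forall>d::nat. 3 \<le> d \<longrightarrow>
        (\<exists>r0::real.
           0.4 * (real d)^2 - 1 < r0 \<and> r0 < 0.42 * (real d)^2 + 2 \<and>
           V1 (real d) r0 / V2 (real d) r0 - U1 (real d) r0 / U2 (real d) r0 = 0 \<and>
           (\<forall>r::real. 0 < r \<and> r < r0 \<longrightarrow>
              V1 (real d) r / V2 (real d) r < U1 (real d) r / U2 (real d) r) \<and>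
           (\<forall>r::real. r0 < r \<longrightarrow>
              U1 (real d) r / U2 (real d) r < V1 (real d) r / V2 (real d) r) \<and>
           (\<forall>r::nat. 0 < r \<and> real r < r0 \<longrightarrow>
              c3 (M1 d r) (ones (d + r)) < c3 (Q1 d r) (ones (d + r))) \<and>
           (\<forall>r::nat. r0 < real r \<longrightarrow>
              c3 (Q1 d r) (ones (d + r)) < c3 (M1 d r) (ones (d + r)))))"
proof (intro conjI allI impI)
  fix n G x d r
  assume "rooted_tree n G x \<and> 2 \<le> n \<and> eccentricity G x = ereal (real d) \<and> r = n - d"
  then show "c3 (Q1 d r) (ones n) < rho (bottleneck_mat n G x)"
    and "c3 (M1 d r) (ones n) < rho (bottleneck_mat n G x)"
    using c3_broom_less_rho by auto
next
  fix d r :: nat assume "1 \<le> d \<and> 1 \<le> r"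
  then show "c3 (Q1 d r) (ones (d + r)) = U1 (real d) (real r) / U2 (real d) (real r)"
    and "c3 (M1 d r) (ones (d + r)) = V1 (real d) (real r) / V2 (real d) (real r)"
    using c3_broom by auto
next
  fix d :: nat assume d: "3 \<le> d"
  then have "3 \<le> real d" and d1: "1 \<le> d" by simp_all
  from quotient_difference_sign_change[OF this(1)] obtain r0 where r0:
    "0.4 * (real d)^2 - 1 < r0" "r0 < 0.42 * (real d)^2 + 2" "0 < r0"
    "V1 (real d) r0 / V2 (real d) r0 - U1 (real d) r0 / U2 (real d) r0 = 0"
    "\<And>r. 0 < r \<Longrightarrow> r < r0 \<Longrightarrow> V1 (real d) r / V2 (real d) r < U1 (real d) r / U2 (real d) r"
    "\<And>r. r0 < r \<Longrightarrow> U1 (real d) r / U2 (real d) r < V1 (real d) r / V2 (real d) r"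
    by blast
  show "\<exists>r0::real.
      0.4 * (real d)^2 - 1 < r0 \<and> r0 < 0.42 * (real d)^2 + 2 \<and>
      V1 (real d) r0 / V2 (real d) r0 - U1 (real d) r0 / U2 (real d) r0 = 0 \<and>
      (\<forall>r::real. 0 < r \<and> r < r0 \<longrightarrow> V1 (real d) r / V2 (real d) r < U1 (real d) r / U2 (real d) r) \<and>
      (\<forall>r::real. r0 < r \<longrightarrow> U1 (real d) r / U2 (real d) r < V1 (real d) r / V2 (real d) r) \<and>
      (\<forall>r::nat. 0 < r \<and> real r < r0 \<longrightarrow>
        c3 (M1 d r) (ones (d + r)) < c3 (Q1 d r) (ones (d + r))) \<and>
      (\<forall>r::nat. r0 < real r \<longrightarrow>
        c3 (Q1 d r) (ones (d + r)) < c3 (M1 d r) (ones (d + r)))"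
    unfolding c3_broom[OF d1]
    by (intro exI[of _ r0] conjI allI impI) (use r0 in auto)
qed

end
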